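(* Let $K$ be a field, $\mathcal{H}$ a simple hypergraph on $\{x_1,\dots,x_n\}$, $R=K[x_1,\dots,x_n]$, and $i,j$ integers. (1) Suppose that for all pairwise distinct edges $S_1,\dots,S_{i+1}$ of $\mathcal{H}$ with $S_{i+1}\subseteq\bigcup_{\ell=1}^iS_\ell$ and $|\bigcup_{\ell=1}^iS_\ell|=j$ we have $S_k\nsubseteq\bigcup_{1\le\ell\le i+1,\ell\neq k}S_\ell$ for all $1\le k\le i$. Then the number of self semi-induced matchings in $\mathcal{H}$ of type $(i,j)$ is at most $\beta_{i,j}(R/I(\mathcal{H}))$. (2) Suppose that for all pairwise distinct edges $S_1,\dots,S_i$ of $\mathcal{H}$ (in any order) with $|\bigcup_{\ell=1}^iS_\ell|=j$ we have $S_1\nsubseteq\bigcup_{\ell=2}^iS_\ell$. Then $\beta_{i,j}(R/I(\mathcal{H}))$ is at most the number of self-contained semi-induced matchings in $\mathcal{H}$ of type $(i,j)$.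
   Context: A simple hypergraph $\mathcal{H}$ on $V(\mathcal{H})=\{x_1,\dots,x_n\}$ is a set $\mathcal{E}(\mathcal{H})$ of subsets of $V(\mathcal{H})$ (edges), each of cardinality at least $2$, with no edge contained in another. $R$ is standard graded, $x^S=\prod_{x_i\in S}x_i$, $I(\mathcal{H})=\langle x^S : S\in\mathcal{E}(\mathcal{H})\rangle$, $\beta_{i,j}(R/I)=\dim_K\mathrm{Tor}_i^R(R/I,K)_j$. For a family $\mathcal{S}=\{S_1,\dots,S_i\}$ of distinct edges, its type is $(i,j)$ with $j=|\bigcup_{\ell=1}^iS_\ell|$. $\mathcal{S}$ is a self semi-induced matching if no edge of $\mathcal{H}$ outside $\mathcal{S}$ is contained in $\bigcup_\ell S_\ell$ and for all $k$, $S_k\nsubseteq\bigcup_{\ell\neq k}S_\ell$. $\mathcal{S}$ is a self-contained semi-induced matching if (i) for each $S\in\mathcal{E}(\mathcal{H})\setminus\mathcal{S}$, either $S\nsubseteq\bigcup_{\ell=1}^iS_\ell$ or there is $k$ with $S_k\subseteq S\cup\bigcup_{\ell\neq k}S_\ell$, and (ii) for all $k$, $S_k\nsubseteq\bigcup_{\ell\neq k}S_\ell$. *)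

theory Defs
  imports Main "HOL.Vector_Spaces" "HOL-Library.Function_Algebras"
begin

section \<open>Simple hypergraphs on the vertex set {0..<n} (standing for x_1,...,x_n)\<close>

definition simple_hypergraph :: "nat \<Rightarrow> nat set set \<Rightarrow> bool" where
  "simple_hypergraph n E \<longleftrightarrow>
     (\<forall>S\<in>E. S \<subseteq> {..<n} \<and> 2 \<le> card S) \<and>
     (\<forall>S\<in>E. \<forall>T\<in>E. S \<subseteq> T \<longrightarrow> S = T)"

text \<open>A family of distinct edges is represented as a set of edges; its type is (card, card of union).\<close>

definition self_semi_induced :: "nat set set \<Rightarrow> nat set set \<Rightarrow> bool" where
  "self_semi_induced E \<S> \<longleftrightarrow> \<S> \<subseteq> E \<and>
     (\<forall>S\<in>E - \<S>. \<not> S \<subseteq> \<Union>\<S>) \<and>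
     (\<forall>T\<in>\<S>. \<not> T \<subseteq> \<Union>(\<S> - {T}))"

definition self_contained_semi_induced :: "nat set set \<Rightarrow> nat set set \<Rightarrow> bool" where
  "self_contained_semi_induced E \<S> \<longleftrightarrow> \<S> \<subseteq> E \<and>
     (\<forall>S\<in>E - \<S>. \<not> S \<subseteq> \<Union>\<S> \<or> (\<exists>T\<in>\<S>. T \<subseteq> S \<union> \<Union>(\<S> - {T}))) \<and>
     (\<forall>T\<in>\<S>. \<not> T \<subseteq> \<Union>(\<S> - {T}))"

definition num_self_semi_induced :: "nat set set \<Rightarrow> nat \<Rightarrow> nat \<Rightarrow> nat" where
  "num_self_semi_induced E i j =
     card {\<S>. self_semi_induced E \<S> \<and> card \<S> = i \<and> card (\<Union>\<S>) = j}"

definition num_self_contained_semi_induced :: "nat set set \<Rightarrow> nat \<Rightarrow> nat \<Rightarrow> nat" where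
  "num_self_contained_semi_induced E i j =
     card {\<S>. self_contained_semi_induced E \<S> \<and> card \<S> = i \<and> card (\<Union>\<S>) = j}"

text \<open>Tor_i^R(R/I, K) is computed as the homology of R/I \<otimes>_R (Koszul resolution of K).
  A monomial is an exponent vector m :: nat \<Rightarrow> nat supported on {..<n}; it is nonzero in R/I(H)
  (a standard monomial) iff x^S does not divide it for every edge S, i.e. no edge lies in its support.
  The degree-j part of the i-th chain module (R/I \<otimes> \<Lambda>^i K^n)_j has K-basis the pairs (m, F),
  F \<subseteq> {..<n}, |F| = i, m standard, deg m + i = j (e_k has degree 1).\<close>

definition monomial_ok :: "nat \<Rightarrow> nat set set \<Rightarrow> (nat \<Rightarrow> nat) \<Rightarrow> bool" where
  "monomial_ok n E m \<longleftrightarrow> (\<forall>v. n \<le> v \<longrightarrow> m v = 0) \<and> (\<forall>S\<in>E. \<not> S \<subseteq> {v. 0 < m v})"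

definition kbasis :: "nat \<Rightarrow> nat set set \<Rightarrow> nat \<Rightarrow> nat \<Rightarrow> ((nat \<Rightarrow> nat) \<times> nat set) set" where
  "kbasis n E i j = {(m, F). monomial_ok n E m \<and> F \<subseteq> {..<n} \<and> card F = i \<and>
                             (\<Sum>v<n. m v) + i = j}"

definition kchains :: "nat \<Rightarrow> nat set set \<Rightarrow> nat \<Rightarrow> nat \<Rightarrow> ((nat \<Rightarrow> nat) \<times> nat set \<Rightarrow> 'k::field) set" where
  "kchains n E i j = {c. \<forall>b. b \<notin> kbasis n E i j \<longrightarrow> c b = 0}"

text \<open>Koszul differential d(m \<otimes> e_F) = \<Sum>_{k\<in>F} (-1)^{#{l\<in>F. l<k}} (x_k m) \<otimes> e_{F-{k}},
  written coefficientwise on the target basis (m', G); the term vanishes when x_k m \<in> I.\<close>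

definition kdiff :: "nat \<Rightarrow> nat set set \<Rightarrow> nat \<Rightarrow> nat \<Rightarrow>
    ((nat \<Rightarrow> nat) \<times> nat set \<Rightarrow> 'k::field) \<Rightarrow> ((nat \<Rightarrow> nat) \<times> nat set \<Rightarrow> 'k)" where
  "kdiff n E i j c = (\<lambda>(m', G).
     if (m', G) \<in> kbasis n E (i - 1) j then
       (\<Sum>k \<in> {k. k < n \<and> k \<notin> G \<and> 0 < m' k}.
          (- 1) ^ card {l \<in> G. l < k} * c (m'(k := m' k - 1), insert k G))
     else 0)"

definition kscale :: "'k::field \<Rightarrow> ('b \<Rightarrow> 'k) \<Rightarrow> ('b \<Rightarrow> 'k)" where
  "kscale a f = (\<lambda>x. a * f x)"

text \<open>beta_{i,j}(R/I(H)) = dim_K Tor_i^R(R/I(H), K)_j = dim ker d_i - dim im d_{i+1}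
  (in degree j; d_0 = 0).  The type parameter 'k is the field K.\<close>

definition betti :: "'k::field itself \<Rightarrow> nat \<Rightarrow> nat set set \<Rightarrow> nat \<Rightarrow> nat \<Rightarrow> nat" where
  "betti _ n E i j =
     Vector_Spaces.vector_space.dim (kscale :: 'k \<Rightarrow> _)
        {c \<in> (kchains n E i j :: ((nat \<Rightarrow> nat) \<times> nat set \<Rightarrow> 'k) set). i = 0 \<or> kdiff n E i j c = 0}
     - Vector_Spaces.vector_space.dim (kscale :: 'k \<Rightarrow> _)
        (kdiff n E (i + 1) j ` (kchains n E (i + 1) j :: ((nat \<Rightarrow> nat) \<times> nat set \<Rightarrow> 'k) set))"

end

theory Submission
  imports Defs
begin

text \<open>Both the Koszul complex of \<open>R/I\<close> and the Taylor resolution tensored with \<open>K\<close> are quotients of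
  the tensor product of the Taylor and Koszul resolutions. Both kernels are acyclic, because in
  each multidegree every row (respectively column) of them is a cone. So cycles can be moved between the two
  complexes through this double complex. In the Taylor complex over \<open>K\<close>, the boundary of a family
  of edges is the signed sum of its subfamilies with one redundant edge removed. Hence a self
  semi-induced matching is a cycle that no boundary involves, which gives the lower bound. If all
  families of type \<open>(i, j)\<close> are irredundant, all of them are cycles, and one that is not
  self-contained is, up to sign, the boundary of its union with a suitable further edge; this
  gives the upper bound.\<close>

section \<open>The simplicial boundary operator\<close>

text \<open>The Betti number is defined through the Koszul complex, whereas families of edges live
  in the Taylor complex; the double complex spares an explicit chain map between the two. All
  differentials preserve the multidegree, and the multidegree together with the chosen vertices and
  edges determines the coefficient monomial. So in a fixed multidegree the total complex is the
  augmented chain complex of one simplicial complex whose points are vertices and edges of the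
  hypergraph alike, and a single operator \<open>bd\<close> with a single sign rule serves the whole
  double complex. The cells that survive a projection are closed under adding points within the
  double complex, so the killed cells form a subcomplex. The apex of the cone in a row varies with
  the row, so there is no global cone, and the contraction has to proceed layer by layer. Homology
  groups and induced isomorphisms are never formed: it suffices to lift single cycles and to know
  that a cycle with vanishing projection is a boundary. Independence and spanning are then read off
  in the Taylor coordinates of the lifts.\<close>

definition chains_on :: "'b set \<Rightarrow> ('b \<Rightarrow> 'k::zero) set" where
  "chains_on X = {c. \<forall>x. x \<notin> X \<longrightarrow> c x = 0}"

lemma chainsI: "(\<And>x. x \<notin> X \<Longrightarrow> c x = 0) \<Longrightarrow> c \<in> chains_on X"
  by (simp add: chains_on_def)

lemma chainsD: "c \<in> chains_on X \<Longrightarrow> x \<notin> X \<Longrightarrow> c x = 0"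
  by (simp add: chains_on_def)

lemma chains_mono: "c \<in> chains_on X \<Longrightarrow> X \<subseteq> Y \<Longrightarrow> c \<in> chains_on Y"
  by (auto simp: chains_on_def)

lemma chains_diff: "f \<in> chains_on X \<Longrightarrow> g \<in> chains_on X \<Longrightarrow> (f - g :: _ \<Rightarrow> 'k::ab_group_add) \<in> chains_on X"
  by (simp add: chains_on_def)

lemma chains_add: "f \<in> chains_on X \<Longrightarrow> g \<in> chains_on X \<Longrightarrow> (f + g :: _ \<Rightarrow> 'k::ab_group_add) \<in> chains_on X"
  by (simp add: chains_on_def)

lemma zero_chains: "0 \<in> chains_on X"
  by (simp add: chains_on_def)

lemma chains_kscale: "f \<in> chains_on X \<Longrightarrow> kscale r f \<in> chains_on X"
  by (simp add: chains_on_def kscale_def)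

lemma sum_fun_eval: "(\<Sum>i\<in>A. f i) x = (\<Sum>i\<in>A. f i x :: 'k::comm_monoid_add)"
  by (induction A rule: infinite_finite_induct) auto

lemma chains_sum:
  "(\<And>i. i \<in> A \<Longrightarrow> f i \<in> chains_on X) \<Longrightarrow> (\<Sum>i\<in>A. f i :: _ \<Rightarrow> 'k::comm_monoid_add) \<in> chains_on X"
  by (simp add: chains_on_def sum_fun_eval)

definition ksign :: "nat set \<Rightarrow> nat \<Rightarrow> 'k::comm_ring_1" where
  "ksign \<sigma> k = (- 1) ^ card {l \<in> \<sigma>. l < k}"

lemma ksign_square: "ksign \<sigma> k * ksign \<sigma> k = (1 :: 'k::comm_ring_1)"
  by (simp add: ksign_def flip: power_add mult_2)

lemma ksign_insert_less:
  assumes "k < l" "k \<notin> \<sigma>"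
  shows "ksign (insert k \<sigma>) l = - (ksign \<sigma> l :: 'k::comm_ring_1)"
proof -
  have "{x \<in> insert k \<sigma>. x < l} = insert k {x \<in> \<sigma>. x < l}"
    using assms by auto
  then show ?thesis
    using assms by (simp add: ksign_def)
qed

lemma ksign_insert_ge:
  assumes "l \<le> k"
  shows "ksign (insert k \<sigma>) l = (ksign \<sigma> l :: 'k::comm_ring_1)"
proof -
  have "{x \<in> insert k \<sigma>. x < l} = {x \<in> \<sigma>. x < l}"
    using assms by auto
  then show ?thesis
    by (simp add: ksign_def)
qed

text \<open>Of two points, only the smaller one shifts the position of the other; this gives the
  single minus sign behind \<open>bd_bd\<close>.\<close>

lemma ksign_swap:
  assumes "k \<noteq> l" "k \<notin> \<sigma>" "l \<notin> \<sigma>"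
  shows "ksign \<sigma> k * ksign (insert k \<sigma>) l = - (ksign \<sigma> l * ksign (insert l \<sigma>) k :: 'k::comm_ring_1)"
proof (cases "k < l")
  case True
  then show ?thesis
    using assms by (simp add: ksign_insert_less ksign_insert_ge mult.commute)
next
  case False
  then show ?thesis
    using assms by (simp add: ksign_insert_less ksign_insert_ge mult.commute)
qed

text \<open>The first component of a basis element is a multidegree, a parameter which the boundary
  does not touch.\<close>

definition bd :: "nat \<Rightarrow> ('a \<times> nat set \<Rightarrow> 'k::comm_ring_1) \<Rightarrow> 'a \<times> nat set \<Rightarrow> 'k" where
  "bd N c = (\<lambda>(a, \<sigma>). \<Sum>k \<in> {..<N} - \<sigma>. ksign \<sigma> k * c (a, insert k \<sigma>))"

lemma bd_apply: "bd N c (a, \<sigma>) = (\<Sum>k \<in> {..<N} - \<sigma>. ksign \<sigma> k * c (a, insert k \<sigma>))"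
  by (simp add: bd_def)

lemma bd_zero: "bd N 0 = 0"
  by (auto simp: bd_def)

lemma bd_diff: "bd N (f - g) = bd N f - bd N g"
  by (auto simp: bd_def fun_eq_iff right_diff_distrib sum_subtractf)

lemma bd_add: "bd N (f + g) = bd N f + bd N g"
  by (auto simp: bd_def fun_eq_iff distrib_left sum.distrib)

lemma bd_kscale: "bd N (kscale r f) = kscale r (bd N f)"
  by (auto simp: bd_def kscale_def fun_eq_iff sum_distrib_left mult.left_commute intro!: sum.cong)

lemma bd_sum: "bd N (\<Sum>i\<in>A. f i) = (\<Sum>i\<in>A. bd N (f i))"
proof (induction A rule: infinite_finite_induct)
  case (insert x F)
  have "bd N (sum f (insert x F)) = bd N (f x + sum f F)"
    using insert.hyps by (subst sum.insert) (rule refl | assumption)+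
  also have "\<dots> = bd N (f x) + (\<Sum>i\<in>F. bd N (f i))"
    by (simp only: bd_add insert.IH)
  also have "\<dots> = (\<Sum>i\<in>insert x F. bd N (f i))"
    using insert.hyps by (subst sum.insert) (rule refl | assumption)+
  finally show ?case .
qed (simp_all add: bd_zero[unfolded zero_fun_def])

lemma bd_bd: "bd N (bd N c) = 0"
proof (rule ext, clarsimp)
  fix a :: 'a and \<sigma> :: "nat set"
  let ?A = "{..<N} - \<sigma>"
  let ?g = "\<lambda>k l. ksign \<sigma> k * ksign (insert k \<sigma>) l * c (a, insert l (insert k \<sigma>))"
  have "bd N (bd N c) (a, \<sigma>) = (\<Sum>k\<in>?A. \<Sum>l\<in>?A - {k}. ?g k l)"
    unfolding bd_apply sum_distrib_left
    by (intro sum.cong refl) (auto simp: mult.assoc insert_commute)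
  also have "\<dots> = (\<Sum>k\<in>?A. (\<Sum>l\<in>{l\<in>?A. l < k}. ?g k l) + (\<Sum>l\<in>{l\<in>?A. k < l}. ?g k l))"
  proof (intro sum.cong refl)
    fix k assume "k \<in> ?A"
    have split: "?A - {k} = {l\<in>?A. l < k} \<union> {l\<in>?A. k < l}"
      by auto
    show "(\<Sum>l\<in>?A - {k}. ?g k l) = (\<Sum>l\<in>{l\<in>?A. l < k}. ?g k l) + (\<Sum>l\<in>{l\<in>?A. k < l}. ?g k l)"
      unfolding split by (rule sum.union_disjoint) auto
  qed
  also have "\<dots> = (\<Sum>k\<in>?A. \<Sum>l\<in>{l\<in>?A. l < k}. ?g k l) + (\<Sum>k\<in>?A. \<Sum>l\<in>{l\<in>?A. k < l}. ?g k l)"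
    by (rule sum.distrib)
  \<comment> \<open>Exchanging the sums and renaming matches each pair with its reversal in the
    other part; the two cancel by \<open>ksign_swap\<close>.\<close>
  also have "(\<Sum>k\<in>?A. \<Sum>l\<in>{l\<in>?A. l < k}. ?g k l) = (\<Sum>l\<in>?A. \<Sum>k\<in>{k\<in>?A. l < k}. ?g k l)"
    by (rule sum.swap_restrict) auto
  also have "\<dots> = - (\<Sum>k\<in>?A. \<Sum>l\<in>{l\<in>?A. k < l}. ?g k l)"
    unfolding sum_negf[symmetric]
  proof (intro sum.cong refl)
    fix k l assume "l \<in> ?A" "k \<in> {k\<in>?A. l < k}"
    then show "?g k l = - ?g l k"
      by (subst ksign_swap) (auto simp: insert_commute)
  qed
  finally show "bd N (bd N c) (a, \<sigma>) = 0"
    by simp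
qed

lemma bd_chains:
  assumes "c \<in> chains_on X" and down: "\<And>a \<sigma> k. (a, \<sigma>) \<in> X \<Longrightarrow> k \<in> \<sigma> \<Longrightarrow> (a, \<sigma> - {k}) \<in> X"
  shows "bd N c \<in> chains_on X"
proof (rule chainsI, clarify)
  fix a \<sigma> assume "(a, \<sigma>) \<notin> X"
  then have "c (a, insert k \<sigma>) = 0" if "k \<notin> \<sigma>" for k
    using chainsD[OF assms(1), of "(a, insert k \<sigma>)"] down[of a "insert k \<sigma>" k] that by auto
  then show "bd N c (a, \<sigma>) = 0"
    by (simp add: bd_apply)
qed

section \<open>Acyclicity by toggling a vertex\<close>

definition dgr :: "nat \<Rightarrow> ('a \<times> nat set) set" where
  "dgr i = {x. card (snd x) = i}"

text \<open>The toggling vertex depends only on the multidegree and on the part of the face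
  outside \<open>A\<close>. Toggling it contracts the summand of the boundary that removes vertices of \<open>A\<close>;
  the other summand lowers \<open>card (\<sigma> - A)\<close>, whence the induction.\<close>

lemma toggle_acyclic_aux:
  fixes c :: "'a \<times> nat set \<Rightarrow> 'k::comm_ring_1"
  assumes fin: "\<And>a \<sigma>. (a, \<sigma>) \<in> X \<Longrightarrow> \<sigma> \<subseteq> {..<N}"
    and down: "\<And>a \<sigma> k. (a, \<sigma>) \<in> X \<Longrightarrow> k \<in> \<sigma> \<Longrightarrow> (a, \<sigma> - {k}) \<in> X"
    and tog: "\<And>a \<sigma>. (a, \<sigma>) \<in> X \<Longrightarrow> \<tau> a (\<sigma> - A) \<in> A \<and> (a, insert (\<tau> a (\<sigma> - A)) \<sigma>) \<in> X"
    and "c \<in> chains_on X" "bd N c = 0" "\<And>a \<sigma>. s \<le> card (\<sigma> - A) \<Longrightarrow> c (a, \<sigma>) = 0"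
  shows "\<exists>w\<in>chains_on X. bd N w = c"
  using assms(4-6)
proof (induction s arbitrary: c)
  case 0
  then have "c = 0"
    by auto
  then show ?case
    using zero_chains bd_zero by blast
next
  case (Suc s)
  \<comment> \<open>Cone contraction with apex \<open>t\<close>, restricted to the top layer
    \<open>card (\<sigma> - A) = s\<close>. The sign is the one for which deleting \<open>t\<close>
    returns \<open>c\<close>, so subtracting \<open>bd N h\<close> clears this layer.\<close>
  define h where "h = (\<lambda>(a, \<sigma>). let t = \<tau> a (\<sigma> - A) in
    if t \<in> A \<and> t \<in> \<sigma> \<and> card (\<sigma> - A) = s then ksign (\<sigma> - {t}) t * c (a, \<sigma> - {t}) else 0)"
  have h_chains: "h \<in> chains_on X"
  proof (rule chainsI, clarify, rule ccontr)
    fix a \<sigma> assume not_in: "(a, \<sigma>) \<notin> X" and nz: "h (a, \<sigma>) \<noteq> 0"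
    define t where "t = \<tau> a (\<sigma> - A)"
    have t: "t \<in> A" "t \<in> \<sigma>" "c (a, \<sigma> - {t}) \<noteq> 0"
      using nz unfolding h_def t_def by (auto simp: Let_def split: if_splits)
    then have "(a, \<sigma> - {t}) \<in> X"
      using chainsD[OF Suc.prems(1), of "(a, \<sigma> - {t})"] by blast
    moreover have "\<sigma> - {t} - A = \<sigma> - A"
      using t by auto
    ultimately have "(a, insert t (\<sigma> - {t})) \<in> X"
      using tog[of a "\<sigma> - {t}"] by (simp add: t_def)
    with t not_in show False
      by (simp add: insert_absorb)
  qed
  have key: "bd N h (a, \<sigma>) = c (a, \<sigma>)" if card: "s \<le> card (\<sigma> - A)" for a \<sigma>
  proof (cases "(a, \<sigma>) \<in> X")
    case False
    then show ?thesis
      using chainsD[OF bd_chains[OF h_chains down], of "(a, \<sigma>)"] chainsD[OF Suc.prems(1), of "(a, \<sigma>)"]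
      by simp
  next
    case True
    have fin\<sigma>: "finite \<sigma>" "\<sigma> \<subseteq> {..<N}"
      using fin[OF True] finite_subset by auto
    define t where "t = \<tau> a (\<sigma> - A)"
    have t: "t \<in> A" "(a, insert t \<sigma>) \<in> X"
      using tog[OF True] by (auto simp: t_def)
    then have "t < N"
      using fin by fastforce
    have out: "card (insert k \<sigma> - A) = Suc (card (\<sigma> - A))" if "k \<notin> \<sigma>" "k \<notin> A" for k
      using that fin\<sigma> by (simp add: insert_Diff_if)
    have ins: "insert k \<sigma> - A = \<sigma> - A" if "k \<in> A" for k
      using that by auto
    show ?thesis
    proof (cases "card (\<sigma> - A) = s")
      case False
      then have "card (insert k \<sigma> - A) \<noteq> s" if "k \<notin> \<sigma>" for k
        using that card by (cases "k \<in> A") (simp_all add: out ins)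
      then have "bd N h (a, \<sigma>) = 0"
        by (simp add: bd_apply h_def Let_def)
      moreover have "c (a, \<sigma>) = 0"
        using False card Suc.prems(3) by auto
      ultimately show ?thesis
        by simp
    next
      case cs: True
      have h0: "h (a, insert k \<sigma>) = 0" if "k \<notin> \<sigma>" "k \<notin> A" for k
        using that cs by (simp add: h_def Let_def out)
      have h1: "h (a, insert k \<sigma>) = (if t \<in> insert k \<sigma> then
          ksign (insert k \<sigma> - {t}) t * c (a, insert k \<sigma> - {t}) else 0)" if "k \<in> A" for k
        using that cs t by (simp add: h_def Let_def ins flip: t_def)
      show ?thesis
      proof (cases "t \<in> \<sigma>")
        case False
        have "bd N h (a, \<sigma>) = (\<Sum>k\<in>{t}. ksign \<sigma> k * h (a, insert k \<sigma>))"
          unfolding bd_apply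
        proof (rule sum.mono_neutral_right)
          show "\<forall>k\<in>{..<N} - \<sigma> - {t}. ksign \<sigma> k * h (a, insert k \<sigma>) = 0"
            using h0 h1 False by fastforce
        qed (use \<open>t < N\<close> False in auto)
        also have "\<dots> = ksign \<sigma> t * ksign \<sigma> t * c (a, \<sigma>)"
          using h1[OF t(1)] False by (simp add: mult.assoc)
        finally show ?thesis
          by (simp add: ksign_square)
      next
        case True
        \<comment> \<open>When the apex already lies in \<open>\<sigma>\<close>, the value
          \<open>c (a, \<sigma>)\<close> is recovered from the cycle condition at the smaller face
          \<open>\<rho>\<close>: cofaces of \<open>\<rho>\<close> by a point outside
          \<open>A\<close> lie in layer \<open>Suc s\<close>, where \<open>c\<close>
          vanishes.\<close>
        define \<rho> where "\<rho> = \<sigma> - {t}"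
        have \<rho>: "\<sigma> = insert t \<rho>" "t \<notin> \<rho>"
          using True by (auto simp: \<rho>_def)
        let ?K = "({..<N} - \<sigma>) \<inter> A"
        let ?f = "\<lambda>k. ksign \<rho> k * c (a, insert k \<rho>)"
        have "?f k = 0" if "k \<in> {..<N} - \<sigma> - ?K" for k
        proof -
          have "\<rho> - A = \<sigma> - A"
            using \<rho> t by auto
          then have "card (insert k \<rho> - A) = Suc s"
            using that cs fin\<sigma> \<rho> by (auto simp: insert_Diff_if)
          then show ?thesis
            using Suc.prems(3) by simp
        qed
        then have "sum ?f ({..<N} - \<sigma>) = sum ?f ?K"
          by (intro sum.mono_neutral_right) auto
        moreover have "sum ?f ({..<N} - \<rho>) = ksign \<rho> t * c (a, \<sigma>) + sum ?f ({..<N} - \<sigma>)"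
        proof -
          have split: "{..<N} - \<rho> = insert t ({..<N} - \<sigma>)"
            using \<rho> \<open>t < N\<close> by auto
          show ?thesis
            unfolding split using True by (subst sum.insert) (simp_all flip: \<rho>(1))
        qed
        moreover have "sum ?f ({..<N} - \<rho>) = 0"
          using fun_cong[OF Suc.prems(2), of "(a, \<rho>)"] by (simp add: bd_apply)
        ultimately have cyc: "sum ?f ?K = - (ksign \<rho> t * c (a, \<sigma>))"
          by (simp add: eq_neg_iff_add_eq_0 add.commute)
        have "bd N h (a, \<sigma>) = (\<Sum>k\<in>?K. ksign \<sigma> k * h (a, insert k \<sigma>))"
          unfolding bd_apply
        proof (rule sum.mono_neutral_right)
          show "\<forall>k\<in>{..<N} - \<sigma> - ?K. ksign \<sigma> k * h (a, insert k \<sigma>) = 0"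
          proof
            fix k assume "k \<in> {..<N} - \<sigma> - ?K"
            then have "k \<notin> \<sigma>" "k \<notin> A"
              by auto
            then show "ksign \<sigma> k * h (a, insert k \<sigma>) = 0"
              by (simp add: h0)
          qed
        qed auto
        also have "\<dots> = (\<Sum>k\<in>?K. - (ksign \<rho> t * ?f k))"
        proof (intro sum.cong refl)
          fix k assume k: "k \<in> ?K"
          then have "insert k \<sigma> - {t} = insert k \<rho>"
            using \<rho> by auto
          then have "ksign \<sigma> k * h (a, insert k \<sigma>)
              = ksign (insert t \<rho>) k * ksign (insert k \<rho>) t * c (a, insert k \<rho>)"
            using h1[of k] k \<rho> by (simp add: mult.assoc)
          \<comment> \<open>A squared sign is inserted to create a product that
            \<open>ksign_swap\<close> can reverse.\<close>
          also have "ksign (insert t \<rho>) k * ksign (insert k \<rho>) t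
              = ksign \<rho> t * ksign \<rho> t * (ksign (insert t \<rho>) k * ksign (insert k \<rho>) t :: 'k)"
            by (simp add: ksign_square)
          also have "\<dots> = ksign \<rho> t * ksign (insert k \<rho>) t * (ksign \<rho> t * ksign (insert t \<rho>) k)"
            by (simp add: ac_simps)
          also have "ksign \<rho> t * ksign (insert t \<rho>) k = - (ksign \<rho> k * ksign (insert k \<rho>) t :: 'k)"
            using k \<rho> by (intro ksign_swap) auto
          also have "ksign \<rho> t * ksign (insert k \<rho>) t * - (ksign \<rho> k * ksign (insert k \<rho>) t)
              = - (ksign \<rho> t * ksign \<rho> k * (ksign (insert k \<rho>) t * ksign (insert k \<rho>) t) :: 'k)"
            by (simp add: ac_simps)
          finally show "ksign \<sigma> k * h (a, insert k \<sigma>) = - (ksign \<rho> t * ?f k)"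
            by (simp add: ksign_square mult.assoc)
        qed
        also have "\<dots> = - (ksign \<rho> t * sum ?f ?K)"
          by (simp add: sum_negf sum_distrib_left)
        also have "\<dots> = ksign \<rho> t * ksign \<rho> t * c (a, \<sigma>)"
          by (simp add: cyc mult.assoc)
        finally show ?thesis
          by (simp add: ksign_square)
      qed
    qed
  qed
  have "\<exists>w\<in>chains_on X. bd N w = c - bd N h"
  proof (rule Suc.IH)
    show "c - bd N h \<in> chains_on X"
      using Suc.prems(1) bd_chains[OF h_chains down] by (rule chains_diff)
    show "bd N (c - bd N h) = 0"
      by (simp only: bd_diff bd_bd Suc.prems(2) diff_self)
  qed (simp add: key)
  then obtain w where "w \<in> chains_on X" "bd N w = c - bd N h"
    by blast
  then show ?case
    using h_chains by (intro bexI[of _ "h + w"] chains_add) (simp_all only: bd_add add_diff_cancel_left' add_diff_eq)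
qed

lemma toggle_acyclic:
  fixes c :: "'a \<times> nat set \<Rightarrow> 'k::comm_ring_1"
  assumes fin: "\<And>a \<sigma>. (a, \<sigma>) \<in> X \<Longrightarrow> \<sigma> \<subseteq> {..<N}"
    and down: "\<And>a \<sigma> k. (a, \<sigma>) \<in> X \<Longrightarrow> k \<in> \<sigma> \<Longrightarrow> (a, \<sigma> - {k}) \<in> X"
    and tog: "\<And>a \<sigma>. (a, \<sigma>) \<in> X \<Longrightarrow> \<tau> a (\<sigma> - A) \<in> A \<and> (a, insert (\<tau> a (\<sigma> - A)) \<sigma>) \<in> X"
    and c: "c \<in> chains_on (X \<inter> dgr i)" "bd N c = 0"
  shows "\<exists>w\<in>chains_on (X \<inter> dgr (Suc i)). bd N w = c"
proof -
  \<comment> \<open>Faces have at most \<open>N\<close> points, so \<open>Suc N\<close> bounds all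
    layers and can start the induction.\<close>
  have "c (a, \<sigma>) = 0" if "Suc N \<le> card (\<sigma> - A)" for a \<sigma>
  proof (rule ccontr)
    assume "c (a, \<sigma>) \<noteq> 0"
    then have "\<sigma> - A \<subseteq> {..<N}"
      using fin[of a \<sigma>] chainsD[OF c(1), of "(a, \<sigma>)"] by blast
    then have "card (\<sigma> - A) \<le> N"
      using card_mono[of "{..<N}"] by fastforce
    with that show False
      by simp
  qed
  moreover have "c \<in> chains_on X"
    using c(1) by (rule chains_mono) auto
  ultimately have "\<exists>w\<in>chains_on X. bd N w = c"
    by (intro toggle_acyclic_aux[where s = "Suc N" and A = A and \<tau> = \<tau>] fin down tog c(2))
  then obtain w where w: "w \<in> chains_on X" "bd N w = c"
    by blast
  \<comment> \<open>\<open>bd\<close> lowers the number of points by exactly one and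
    \<open>c\<close> is homogeneous, so only the part of \<open>w\<close> in degree
    \<open>Suc i\<close> contributes to \<open>c\<close>.\<close>
  define w' where "w' = (\<lambda>x. if x \<in> dgr (Suc i) then w x else 0)"
  have "bd N w' (a, \<sigma>) = c (a, \<sigma>)" for a \<sigma>
  proof (cases "(a, \<sigma>) \<in> X")
    case True
    then have "finite \<sigma>"
      using fin finite_subset by blast
    then have deg: "(a, insert k \<sigma>) \<in> dgr (Suc i) \<longleftrightarrow> (a, \<sigma>) \<in> dgr i" if "k \<notin> \<sigma>" for k
      using that by (simp add: dgr_def)
    show ?thesis
    proof (cases "(a, \<sigma>) \<in> dgr i")
      case True
      then have "bd N w' (a, \<sigma>) = bd N w (a, \<sigma>)"
        unfolding bd_apply using deg by (intro sum.cong) (auto simp: w'_def)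
      then show ?thesis
        using w by simp
    next
      case False
      then have "bd N w' (a, \<sigma>) = 0"
        unfolding bd_apply using deg by (intro sum.neutral) (auto simp: w'_def)
      then show ?thesis
        using chainsD[OF c(1), of "(a, \<sigma>)"] False by simp
    qed
  next
    case False
    have "w' \<in> chains_on X"
      using w by (simp add: w'_def chains_on_def)
    then have "bd N w' (a, \<sigma>) = 0"
      using chainsD[OF bd_chains[OF _ down], of w' "(a, \<sigma>)"] False by simp
    then show ?thesis
      using chainsD[OF c(1), of "(a, \<sigma>)"] False by simp
  qed
  then have "bd N w' = c"
    by auto
  moreover have "w' \<in> chains_on (X \<inter> dgr (Suc i))"
    using w by (auto simp: w'_def chains_on_def)
  ultimately show ?thesis
    by blast
qed

section \<open>Dimension counts\<close>

context vector_space
begin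

text \<open>\<open>T\<close> certifies finite dimension. This matters because \<open>dim\<close> is
  the cardinality of a basis, which is 0 for an infinite one, and the function space used later is
  infinite-dimensional.\<close>

lemma finite_basis_exists:
  assumes "finite T" "Z \<subseteq> span T"
  obtains b where "finite b" "b \<subseteq> Z" "independent b" "Z \<subseteq> span b" "card b = dim Z"
proof -
  obtain b where b: "b \<subseteq> Z" "independent b" "Z \<subseteq> span b" "card b = dim Z"
    by (rule basis_exists)
  then have "finite b"
    using independent_span_bound[OF assms(1)] assms(2) by blast
  with b show ?thesis
    by (rule that[rotated])
qed

lemma dim_le_dim_add_card:
  assumes "finite T" "Z \<subseteq> span T" "B \<subseteq> Z" "finite G" "Z \<subseteq> span (B \<union> G)"
  shows "dim Z \<le> dim B + card G"
proof -
  obtain b where b: "finite b" "B \<subseteq> span b" "card b = dim B"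
    using finite_basis_exists[of T B] assms by (metis subset_trans)
  obtain z where z: "z \<subseteq> Z" "independent z" "card z = dim Z"
    using finite_basis_exists[of T Z] assms by metis
  have "B \<union> G \<subseteq> span (b \<union> G)"
    using b(2) span_mono[of b "b \<union> G"] span_superset[of "b \<union> G"] by blast
  then have "z \<subseteq> span (b \<union> G)"
    using z(1) assms(5) span_minimal[OF _ subspace_span] by blast
  then have "card z \<le> card (b \<union> G)"
    using independent_span_bound z(2) b(1) assms(4) by blast
  also have "\<dots> \<le> card b + card G"
    by (rule card_Un_le)
  finally show ?thesis
    using b z by simp
qed

text \<open>The \<open>g i\<close> are linearly independent modulo \<open>B\<close>, so a basis of
  \<open>B\<close> can be enlarged by them one at a time. The invariant of the induction is that the
  span so far is congruent modulo \<open>B\<close> to combinations of the \<open>g i\<close> already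
  used.\<close>

lemma dim_add_card_le:
  assumes "finite T" "Z \<subseteq> span T" "B \<subseteq> Z" "subspace B" "finite I" "g ` I \<subseteq> Z"
    and indep: "\<And>c. (\<Sum>i\<in>I. scale (c i) (g i)) \<in> B \<Longrightarrow> \<forall>i\<in>I. c i = 0"
  shows "dim B + card I \<le> dim Z"
proof -
  obtain b where b: "finite b" "b \<subseteq> B" "independent b" "B \<subseteq> span b" "card b = dim B"
    using finite_basis_exists[of T B] assms by (metis subset_trans)
  have "\<exists>b'. finite b' \<and> b' \<subseteq> Z \<and> independent b' \<and> card b' = card b + card J \<and>
    (\<forall>x\<in>span b'. \<exists>c. x - (\<Sum>i\<in>J. scale (c i) (g i)) \<in> B)" if "J \<subseteq> I" for J
    using finite_subset[OF that assms(5)] that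
  proof (induction J rule: finite_induct)
    case empty
    have "span b \<subseteq> B"
      using b(2) assms(4) by (rule span_minimal)
    then show ?case
      using b assms(3) by (intro exI[of _ b]) auto
  next
    case (insert x J)
    then obtain b' where b': "finite b'" "b' \<subseteq> Z" "independent b'" "card b' = card b + card J"
      and red: "\<And>x. x \<in> span b' \<Longrightarrow> \<exists>c. x - (\<Sum>i\<in>J. scale (c i) (g i)) \<in> B"
      by auto
    have x: "x \<in> I" "g x \<in> Z" and J: "J \<subseteq> I"
      using insert.prems assms(6) by auto
    have new: "g x \<notin> span b'"
    proof
      assume "g x \<in> span b'"
      then obtain c where c: "g x - (\<Sum>i\<in>J. scale (c i) (g i)) \<in> B"
        using red by blast
      \<comment> \<open>Coefficients of the forbidden relation between \<open>g x\<close> and the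
        earlier vectors, extended by zero to \<open>I\<close>.\<close>
      define c' where "c' i = (if i = x then 1 else if i \<in> J then - c i else 0)" for i
      have "(\<Sum>i\<in>I. scale (c' i) (g i)) = (\<Sum>i\<in>insert x J. scale (c' i) (g i))"
        using insert.prems assms(5) by (intro sum.mono_neutral_right) (auto simp: c'_def)
      also have "\<dots> = g x + (\<Sum>i\<in>J. scale (c' i) (g i))"
        using insert.hyps by (simp add: c'_def)
      also have "(\<Sum>i\<in>J. scale (c' i) (g i)) = (\<Sum>i\<in>J. - scale (c i) (g i))"
        using insert.hyps by (intro sum.cong) (auto simp: c'_def)
      finally have "(\<Sum>i\<in>I. scale (c' i) (g i)) \<in> B"
        using c by (simp add: sum_negf)
      then have "c' x = 0"
        using indep x by blast
      then show False
        by (simp add: c'_def)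
    qed
    then have "g x \<notin> b'"
      using span_base by blast
    moreover have "\<exists>c. y - (\<Sum>i\<in>insert x J. scale (c i) (g i)) \<in> B" if y: "y \<in> span (insert (g x) b')" for y
    proof -
      obtain r where "y - scale r (g x) \<in> span b'"
        using y by (auto simp: span_breakdown_eq)
      then obtain c where c: "y - scale r (g x) - (\<Sum>i\<in>J. scale (c i) (g i)) \<in> B"
        using red by blast
      have "(\<Sum>i\<in>J. scale ((c(x := r)) i) (g i)) = (\<Sum>i\<in>J. scale (c i) (g i))"
        using insert.hyps by (intro sum.cong) auto
      with c insert.hyps show ?thesis
        by (intro exI[of _ "c(x := r)"]) (simp add: diff_diff_eq)
    qed
    moreover have "independent (insert (g x) b')"
      using new b'(3) by (rule independent_insertI)
    ultimately show ?case
      using b' x insert.hyps by (intro exI[of _ "insert (g x) b'"]) simp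
  qed
  from this[OF subset_refl] obtain b' where
    b': "b' \<subseteq> Z" "independent b'" "card b' = card b + card I"
    by auto
  obtain z where z: "finite z" "Z \<subseteq> span z" "card z = dim Z"
    using finite_basis_exists[of T Z] assms by metis
  have "card b' \<le> card z"
    using independent_span_bound[OF z(1) b'(2)] b'(1) z(2) by auto
  then show ?thesis
    using b b' z by simp
qed

end

interpretation fun_space: vector_space "kscale :: 'k::field \<Rightarrow> ('b \<Rightarrow> 'k) \<Rightarrow> 'b \<Rightarrow> 'k"
  by unfold_locales (auto simp: kscale_def algebra_simps fun_eq_iff)

definition point :: "'b \<Rightarrow> 'b \<Rightarrow> 'k::zero_neq_one" where
  "point x = (\<lambda>y. of_bool (y = x))"

lemma chains_on_subset_span:
  assumes "finite X"
  shows "chains_on X \<subseteq> fun_space.span (point ` X :: ('b \<Rightarrow> 'k::field) set)"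
proof
  fix f :: "'b \<Rightarrow> 'k" assume "f \<in> chains_on X"
  then have "f = (\<Sum>x\<in>X. kscale (f x) (point x))"
    using assms
    by (auto simp: fun_eq_iff sum_fun_eval kscale_def point_def of_bool_def chains_on_def if_distrib
        cong: if_cong)
  also have "\<dots> \<in> fun_space.span (point ` X)"
    by (intro fun_space.span_sum fun_space.span_scale fun_space.span_base) auto
  finally show "f \<in> fun_space.span (point ` X)" .
qed

section \<open>The tensor product of the Taylor and Koszul complexes\<close>

text \<open>A pair \<open>(a, \<sigma>)\<close> encodes the basis element of multidegree \<open>a\<close> of the tensor product of the
  Taylor resolution of \<open>R/I\<close> with the Koszul resolution of \<open>K\<close>: the indices \<open>u \<in> \<sigma>\<close> with \<open>u \<ge> n\<close> are
  the edges \<open>e u\<close> of the Taylor factor, the others are the vertices of the Koszul factor. The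
  coefficient monomial has exponent vector \<open>a v - [v \<in> \<sigma>] - [v \<in> cover \<sigma>]\<close>. Vertices precede
  edges, so that the signs on the Koszul part agree with those of \<open>kdiff\<close>.\<close>

locale hypergraph_enum =
  fixes n N j :: nat and E :: "nat set set" and e :: "nat \<Rightarrow> nat set"
  assumes simple: "simple_hypergraph n E" and enum: "bij_betw e {n..<N} E" and le: "n \<le> N"
begin

lemma edge_in: "n \<le> u \<Longrightarrow> u < N \<Longrightarrow> e u \<in> E"
  using enum by (auto simp: bij_betw_def)

lemma edge_obtain:
  assumes "S \<in> E"
  obtains u where "n \<le> u" "u < N" "e u = S"
  using enum assms by (auto simp: bij_betw_def)

lemma edge_inj: "e u = e u' \<longleftrightarrow> u = u'" if "n \<le> u" "u < N" "n \<le> u'" "u' < N"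
  using enum that by (auto simp: bij_betw_def inj_on_def)

lemma edge_bound: "S \<in> E \<Longrightarrow> v \<in> S \<Longrightarrow> v < n"
  using simple by (auto simp: simple_hypergraph_def)

definition cover :: "nat set \<Rightarrow> nat set" where
  "cover \<sigma> = (\<Union>u\<in>{u \<in> \<sigma>. n \<le> u}. e u)"

lemma cover_diff_vertices: "cover (\<sigma> - {..<n}) = cover \<sigma>"
  by (auto simp: cover_def)

lemma cover_vertices: "\<sigma> \<subseteq> {..<n} \<Longrightarrow> cover \<sigma> = {}"
  by (force simp: cover_def)

lemma cover_insert_vertex: "k < n \<Longrightarrow> cover (insert k \<sigma>) = cover \<sigma>"
  by (auto simp: cover_def)

lemma cover_insert_edge: "n \<le> k \<Longrightarrow> cover (insert k \<sigma>) = e k \<union> cover \<sigma>"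
  by (auto simp: cover_def)

lemma cover_mono: "\<sigma> \<subseteq> \<rho> \<Longrightarrow> cover \<sigma> \<subseteq> cover \<rho>"
  by (auto simp: cover_def)

lemma cover_bound: "\<sigma> \<subseteq> {..<N} \<Longrightarrow> v \<in> cover \<sigma> \<Longrightarrow> v < n"
  using edge_in edge_bound by (fastforce simp: cover_def)

definition cells :: "((nat \<Rightarrow> nat) \<times> nat set) set" where
  "cells = {(a, \<sigma>). \<sigma> \<subseteq> {..<N} \<and> (\<forall>v\<ge>n. a v = 0) \<and> (\<Sum>v<n. a v) = j \<and>
     (\<forall>v<n. of_bool (v \<in> \<sigma>) + of_bool (v \<in> cover \<sigma>) \<le> a v)}"

text \<open>Projecting the double complex to these cells kills one of the two factors: the first
  projection yields \<open>R/I\<close> tensored with the Koszul complex, the second one \<open>K\<close> tensored with the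
  Taylor complex.\<close>

definition koszul_cells :: "((nat \<Rightarrow> nat) \<times> nat set) set" where
  "koszul_cells = {(a, \<sigma>) \<in> cells. \<sigma> \<subseteq> {..<n} \<and> (\<forall>S\<in>E. \<not> S \<subseteq> {v. of_bool (v \<in> \<sigma>) < a v})}"

definition taylor_cells :: "((nat \<Rightarrow> nat) \<times> nat set) set" where
  "taylor_cells = {(a, \<sigma>) \<in> cells. \<sigma> \<inter> {..<n} = {} \<and> a = (\<lambda>v. of_bool (v \<in> cover \<sigma>))}"

section \<open>The killed cells form acyclic subcomplexes\<close>

lemma koszul_cells_subset: "koszul_cells \<subseteq> cells"
  by (auto simp: koszul_cells_def)

lemma taylor_cells_subset: "taylor_cells \<subseteq> cells"
  by (auto simp: taylor_cells_def)

lemma cells_finite: "(a, \<sigma>) \<in> cells \<Longrightarrow> finite \<sigma>"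
  by (auto simp: cells_def intro: finite_subset)

lemma cells_down: "(a, \<sigma> - {k}) \<in> cells" if "(a, \<sigma>) \<in> cells"
proof -
  have "of_bool (v \<in> \<sigma> - {k}) + of_bool (v \<in> cover (\<sigma> - {k})) \<le> a v" if "v < n" for v
  proof -
    have "of_bool (v \<in> \<sigma> - {k}) + of_bool (v \<in> cover (\<sigma> - {k}))
        \<le> (of_bool (v \<in> \<sigma>) + of_bool (v \<in> cover \<sigma>) :: nat)"
      using cover_mono[of "\<sigma> - {k}" \<sigma>] by (intro add_mono) auto
    also have "\<dots> \<le> a v"
      using \<open>(a, \<sigma>) \<in> cells\<close> that by (simp add: cells_def)
    finally show ?thesis .
  qed
  then show ?thesis
    using that by (auto simp: cells_def)
qed

text \<open>Makes the complement of the Koszul cells a subcomplex. A new edge would divide the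
  coefficient monomial of the smaller cell, which is standard; a new vertex is divided out of that
  monomial and leaves it standard.\<close>

lemma koszul_cells_up:
  assumes "(a, \<sigma>) \<in> cells" "k \<in> \<sigma>" "(a, \<sigma> - {k}) \<in> koszul_cells"
  shows "(a, \<sigma>) \<in> koszul_cells"
proof -
  have "k < n"
  proof (rule ccontr)
    assume k: "\<not> k < n"
    then have "e k \<in> E" "e k \<subseteq> cover \<sigma>"
      using assms edge_in[of k] by (auto simp: cells_def cover_def)
    moreover have "of_bool (v \<in> \<sigma> - {k}) < a v" if "v \<in> e k" for v
    proof -
      have "v < n" "v \<in> cover \<sigma>"
        using that calculation edge_bound by auto
      then have "of_bool (v \<in> \<sigma>) + 1 \<le> a v"
        using assms(1) by (auto simp: cells_def)
      then show ?thesis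
        by auto
    qed
    ultimately show False
      using assms(3) by (auto simp: koszul_cells_def)
  qed
  moreover have "{v. of_bool (v \<in> \<sigma>) < a v} \<subseteq> {v. of_bool (v \<in> \<sigma> - {k}) < a v}"
    by auto
  ultimately show ?thesis
    using assms unfolding koszul_cells_def by blast
qed

text \<open>The smaller cell has coefficient monomial 1, so there is no room for a vertex, and an
  added edge must lie in the old cover.\<close>

lemma taylor_cells_up:
  assumes "(a, \<sigma>) \<in> cells" "k \<in> \<sigma>" "(a, \<sigma> - {k}) \<in> taylor_cells"
  shows "(a, \<sigma>) \<in> taylor_cells"
proof -
  have a: "a v = of_bool (v \<in> cover (\<sigma> - {k}))" for v
    using assms by (simp add: taylor_cells_def)
  have bnd: "of_bool (v \<in> \<sigma>) + of_bool (v \<in> cover \<sigma>) \<le> a v" if "v < n" for v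
    using assms that by (simp add: cells_def)
  have mono: "cover (\<sigma> - {k}) \<subseteq> cover \<sigma>"
    by (rule cover_mono) auto
  have "\<not> k < n"
  proof
    assume "k < n"
    with bnd[of k] a[of k] mono assms(2) show False
      by (auto split: if_splits simp: of_bool_def)
  qed
  moreover have "v \<in> cover \<sigma> \<longleftrightarrow> v \<in> cover (\<sigma> - {k})" for v
  proof
    assume "v \<in> cover \<sigma>"
    then show "v \<in> cover (\<sigma> - {k})"
      using bnd[of v] a[of v] cover_bound[of \<sigma> v] assms(1) by (auto simp: cells_def of_bool_def split: if_splits)
  qed (use mono in auto)
  ultimately show ?thesis
    using assms unfolding taylor_cells_def by auto
qed

text \<open>Exactness of the Taylor resolution, row by row: for a fixed Koszul part, the admissible
  edge sets are all sets of edges that divide the remaining monomial, hence a full simplex. Outside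
  the Koszul cells at least one such edge exists and serves as apex.\<close>

lemma acyclic_koszul:
  fixes c :: "_ \<Rightarrow> 'k::field"
  assumes "c \<in> chains_on ((cells - koszul_cells) \<inter> dgr i)" "bd N c = 0"
  shows "\<exists>w\<in>chains_on ((cells - koszul_cells) \<inter> dgr (Suc i)). bd N w = c"
proof (rule toggle_acyclic[where A = "{n..<N}"
      and \<tau> = "\<lambda>a \<rho>. SOME u. u \<in> {n..<N} \<and> (\<forall>v\<in>e u. of_bool (v \<in> \<rho>) < a v)"])
  fix a :: "nat \<Rightarrow> nat" and \<sigma> assume as: "(a, \<sigma>) \<in> cells - koszul_cells"
  let ?P = "\<lambda>u. u \<in> {n..<N} \<and> (\<forall>v\<in>e u. of_bool (v \<in> \<sigma> - {n..<N}) < a v)"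
  define w where "w = (SOME u. ?P u)"
  have vert: "of_bool (v \<in> \<sigma> - {n..<N}) \<le> (of_bool (v \<in> \<sigma>) :: nat)" for v
    by auto
  \<comment> \<open>Without edges in \<open>\<sigma>\<close>, the coefficient monomial is not
    standard and some edge divides it; otherwise an edge already in \<open>\<sigma>\<close>
    serves.\<close>
  have "\<exists>u. ?P u"
  proof (cases "\<sigma> \<subseteq> {..<n}")
    case True
    then obtain S where S: "S \<in> E" "S \<subseteq> {v. of_bool (v \<in> \<sigma>) < a v}"
      using as by (auto simp: koszul_cells_def)
    then obtain u where "n \<le> u" "u < N" "e u = S"
      using edge_obtain by blast
    moreover have "\<forall>v\<in>S. of_bool (v \<in> \<sigma> - {n..<N}) < a v"
      using S(2) by (intro ballI le_less_trans[OF vert]) blast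
    ultimately show ?thesis
      by (intro exI[of _ u]) simp
  next
    case False
    then obtain u where u: "u \<in> \<sigma>" "n \<le> u" "u < N"
      using as by (force simp: cells_def)
    have "of_bool (v \<in> \<sigma>) < a v" if "v \<in> e u" for v
    proof -
      have "v < n" "v \<in> cover \<sigma>"
        using that u edge_in edge_bound by (auto simp: cover_def)
      then have "of_bool (v \<in> \<sigma>) + 1 \<le> a v"
        using as by (auto simp: cells_def)
      then show ?thesis
        by auto
    qed
    then have "\<forall>v\<in>e u. of_bool (v \<in> \<sigma> - {n..<N}) < a v"
      by (intro ballI le_less_trans[OF vert])
    with u show ?thesis
      by (intro exI[of _ u]) simp
  qed
  then have P: "?P w"
    unfolding w_def by (rule someI_ex)
  have lt: "of_bool (v \<in> \<sigma>) < a v" if "v \<in> e w" for v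
  proof -
    have "e w \<in> E"
      using P by (intro edge_in) simp_all
    then have "v < n"
      using that by (rule edge_bound)
    then have "v \<in> \<sigma> - {n..<N} \<longleftrightarrow> v \<in> \<sigma>"
      by auto
    moreover have "of_bool (v \<in> \<sigma> - {n..<N}) < a v"
      using P that by blast
    ultimately show ?thesis
      by simp
  qed
  have "of_bool (v \<in> insert w \<sigma>) + of_bool (v \<in> cover (insert w \<sigma>)) \<le> a v" if "v < n" for v
  proof (cases "v \<in> e w")
    case True
    then show ?thesis
      using lt[OF True] that P by (auto simp: of_bool_def)
  next
    case False
    have "of_bool (v \<in> \<sigma>) + of_bool (v \<in> cover \<sigma>) \<le> a v"
      using as that by (auto simp: cells_def)
    then show ?thesis
      using False that P by (auto simp: cover_insert_edge)
  qed
  then have "(a, insert w \<sigma>) \<in> cells"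
    using as P by (auto simp: cells_def)
  moreover have "(a, insert w \<sigma>) \<notin> koszul_cells"
    using P by (auto simp: koszul_cells_def)
  ultimately show "(SOME u. ?P u) \<in> {n..<N} \<and> (a, insert (SOME u. ?P u) \<sigma>) \<in> cells - koszul_cells"
    using P unfolding w_def by blast
next
  fix a \<sigma> k assume "(a, \<sigma>) \<in> cells - koszul_cells" "k \<in> \<sigma>"
  then show "(a, \<sigma> - {k}) \<in> cells - koszul_cells"
    using cells_down[of a \<sigma> k] koszul_cells_up[of a \<sigma> k] by auto
qed (use assms in \<open>simp_all add: cells_def\<close>)

text \<open>Exactness of the Koszul resolution, column by column: for a fixed edge set, the
  admissible vertex sets are all subsets of the support of \<open>a\<close> minus the cover. An apex
  is missing only if this support is empty, and that is the case of a Taylor cell.\<close>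

lemma acyclic_taylor:
  fixes c :: "_ \<Rightarrow> 'k::field"
  assumes "c \<in> chains_on ((cells - taylor_cells) \<inter> dgr i)" "bd N c = 0"
  shows "\<exists>w\<in>chains_on ((cells - taylor_cells) \<inter> dgr (Suc i)). bd N w = c"
proof (rule toggle_acyclic[where A = "{..<n}"
      and \<tau> = "\<lambda>a \<rho>. SOME v. v < n \<and> of_bool (v \<in> cover \<rho>) < a v"])
  fix a :: "nat \<Rightarrow> nat" and \<sigma> assume as: "(a, \<sigma>) \<in> cells - taylor_cells"
  let ?P = "\<lambda>v. v < n \<and> of_bool (v \<in> cover (\<sigma> - {..<n})) < a v"
  define w where "w = (SOME v. ?P v)"
  have sub: "\<sigma> \<subseteq> {..<N}" and bnd: "\<And>v. v < n \<Longrightarrow> of_bool (v \<in> \<sigma>) + of_bool (v \<in> cover \<sigma>) \<le> a v"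
    and out: "\<And>v. n \<le> v \<Longrightarrow> a v = 0"
    using as by (auto simp: cells_def)
  have "\<exists>v. ?P v"
  proof (rule ccontr)
    assume none: "\<not> (\<exists>v. ?P v)"
    have eq: "a v = of_bool (v \<in> cover \<sigma>) \<and> (v < n \<longrightarrow> v \<notin> \<sigma>)" for v
    proof (cases "v < n")
      case True
      then show ?thesis
        using none bnd[of v] by (fastforce simp: cover_diff_vertices not_less)
    next
      case False
      then show ?thesis
        using out[of v] cover_bound[OF sub] by auto
    qed
    then have "(a, \<sigma>) \<in> taylor_cells"
      using as by (auto simp: taylor_cells_def)
    with as show False
      by blast
  qed
  then have P: "?P w"
    unfolding w_def by (rule someI_ex)
  have "of_bool (v \<in> insert w \<sigma>) + of_bool (v \<in> cover (insert w \<sigma>)) \<le> a v" if "v < n" for v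
  proof (cases "v = w")
    case True
    then show ?thesis
      using P by (simp add: cover_insert_vertex cover_diff_vertices flip: True)
  next
    case False
    then show ?thesis
      using P bnd[OF that] by (simp add: cover_insert_vertex)
  qed
  then have "(a, insert w \<sigma>) \<in> cells"
    using as P le by (auto simp: cells_def)
  moreover have "(a, insert w \<sigma>) \<notin> taylor_cells"
    using P by (auto simp: taylor_cells_def)
  ultimately show "(SOME v. ?P v) \<in> {..<n} \<and> (a, insert (SOME v. ?P v) \<sigma>) \<in> cells - taylor_cells"
    using P unfolding w_def by blast
next
  fix a \<sigma> k assume "(a, \<sigma>) \<in> cells - taylor_cells" "k \<in> \<sigma>"
  then show "(a, \<sigma> - {k}) \<in> cells - taylor_cells"
    using cells_down[of a \<sigma> k] taylor_cells_up[of a \<sigma> k] by auto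
qed (use assms in \<open>simp_all add: cells_def\<close>)

section \<open>Moving cycles through the double complex\<close>

lemma bd_degree:
  assumes "z \<in> chains_on (cells \<inter> dgr (Suc i))"
  shows "bd N z \<in> chains_on (cells \<inter> dgr i)"
proof (rule chainsI, clarify)
  fix a \<sigma> assume not_in: "(a, \<sigma>) \<notin> cells \<inter> dgr i"
  have "(a, insert k \<sigma>) \<notin> cells \<inter> dgr (Suc i)" if "k \<notin> \<sigma>" for k
  proof
    assume "(a, insert k \<sigma>) \<in> cells \<inter> dgr (Suc i)"
    then show False
      using not_in that cells_down[of a "insert k \<sigma>" k] cells_finite[of a "insert k \<sigma>"]
      by (auto simp: dgr_def)
  qed
  then show "bd N z (a, \<sigma>) = 0"
    using chainsD[OF assms] by (simp add: bd_apply)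
qed

lemma bd_degree_0:
  assumes "z \<in> chains_on (cells \<inter> dgr 0)"
  shows "bd N z = 0"
proof (rule ext, clarify)
  fix a \<sigma>
  have "(a, insert k \<sigma>) \<notin> cells \<inter> dgr 0" for k
    using cells_finite[of a "insert k \<sigma>"] by (auto simp: dgr_def card_gt_0_iff)
  then show "bd N z (a, \<sigma>) = 0 (a, \<sigma>)"
    using chainsD[OF assms] by (simp add: bd_apply)
qed

text \<open>The boundary of \<open>z\<close> is a cycle in the acyclic kernel, so it is
  \<open>bd N w\<close> with \<open>w\<close> in the kernel, and \<open>z - w\<close> is the
  lift.\<close>

lemma lift_along_projection:
  fixes z :: "_ \<Rightarrow> 'k::field"
  assumes R: "R = koszul_cells \<or> R = taylor_cells"
    and z: "z \<in> chains_on (cells \<inter> dgr i)" and cyc: "\<And>x. x \<in> R \<Longrightarrow> bd N z x = 0"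
  shows "\<exists>z'\<in>chains_on (cells \<inter> dgr i). bd N z' = 0 \<and> (\<forall>x\<in>R. z' x = z x)"
proof (cases i)
  case 0
  then show ?thesis
    using z bd_degree_0 by blast
next
  case (Suc i')
  have "bd N z \<in> chains_on ((cells - R) \<inter> dgr i')"
    using bd_degree[of z i'] z cyc Suc by (auto simp: chains_on_def)
  then obtain w where w: "w \<in> chains_on ((cells - R) \<inter> dgr i)" "bd N w = bd N z"
    using R acyclic_koszul[of "bd N z" i'] acyclic_taylor[of "bd N z" i'] Suc by (auto simp: bd_bd)
  have "w \<in> chains_on (cells \<inter> dgr i)"
    using w(1) by (rule chains_mono) auto
  moreover have "w x = 0" if "x \<in> R" for x
    using chainsD[OF w(1), of x] that by auto
  ultimately show ?thesis
    using z w by (intro bexI[of _ "z - w"]) (auto simp: bd_diff chains_diff)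
qed

text \<open>Together with \<open>lift_along_projection\<close> this replaces the statement that both
  projections are isomorphisms on homology.\<close>

lemma boundary_if_projection_zero:
  fixes z :: "_ \<Rightarrow> 'k::field"
  assumes R: "R = koszul_cells \<or> R = taylor_cells"
    and z: "z \<in> chains_on (cells \<inter> dgr i)" "bd N z = 0" and "\<And>x. x \<in> R \<Longrightarrow> z x = 0"
  shows "\<exists>w\<in>chains_on ((cells - R) \<inter> dgr (Suc i)). bd N w = z"
proof -
  have "z \<in> chains_on ((cells - R) \<inter> dgr i)"
    using assms by (auto simp: chains_on_def)
  then show ?thesis
    using R acyclic_koszul[of z i] acyclic_taylor[of z i] z(2) by auto
qed

section \<open>Identification with the Koszul complex of \<open>R/I\<close>\<close>

text \<open>Cells are indexed by multidegree, \<open>kbasis\<close> by coefficient monomial; the two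
  differ by the indicator of \<open>F\<close>.\<close>

lemma kbasis_iff:
  "(m, F) \<in> kbasis n E i j \<longleftrightarrow> (\<lambda>v. m v + of_bool (v \<in> F), F) \<in> koszul_cells \<inter> dgr i"
proof (cases "F \<subseteq> {..<n}")
  case True
  have "(\<Sum>v<n. of_bool (v \<in> F)) = card F"
    using True by (simp add: Int_absorb1)
  moreover have "(\<forall>v\<ge>n. m v + of_bool (v \<in> F) = 0) \<longleftrightarrow> (\<forall>v\<ge>n. m v = 0)"
    using True by auto
  moreover have "F \<subseteq> {..<N}"
    using True le by auto
  ultimately show ?thesis
    using True
    by (auto simp: kbasis_def monomial_ok_def koszul_cells_def cells_def dgr_def sum.distrib
        cover_vertices)
next
  case False
  then show ?thesis
    by (auto simp: kbasis_def koszul_cells_def)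
qed

lemma finite_kbasis: "finite (kbasis n E i j)"
proof (rule finite_subset)
  show "kbasis n E i j \<subseteq>
      {m. \<forall>v. (v \<in> {..<n} \<longrightarrow> m v \<in> {..j}) \<and> (v \<notin> {..<n} \<longrightarrow> m v = 0)} \<times> Pow {..<n}"
  proof clarify
    fix m F assume mF: "(m, F) \<in> kbasis n E i j"
    have "m v \<le> j" if "v < n" for v
    proof -
      have "m v \<le> (\<Sum>v<n. m v)"
        using that by (intro member_le_sum) auto
      then show ?thesis
        using mF by (auto simp: kbasis_def)
    qed
    then show "m \<in> {m. \<forall>v. (v \<in> {..<n} \<longrightarrow> m v \<in> {..j}) \<and> (v \<notin> {..<n} \<longrightarrow> m v = 0)} \<and> F \<in> Pow {..<n}"
      using mF by (auto simp: kbasis_def monomial_ok_def)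
  qed
  show "finite ({m. \<forall>v. (v \<in> {..<n} \<longrightarrow> m v \<in> {..j}) \<and> (v \<notin> {..<n} \<longrightarrow> m v = (0::nat))} \<times> Pow {..<n})"
    by (intro finite_cartesian_product finite_set_of_finite_funs) auto
qed

definition koszul_part ::
    "nat \<Rightarrow> ((nat \<Rightarrow> nat) \<times> nat set \<Rightarrow> 'k::field) \<Rightarrow> (nat \<Rightarrow> nat) \<times> nat set \<Rightarrow> 'k" where
  "koszul_part i c =
     (\<lambda>(m, F). if (m, F) \<in> kbasis n E i j then c (\<lambda>v. m v + of_bool (v \<in> F), F) else 0)"

text \<open>Extension by zero outside the Koszul cells. It does not commute with the differentials
  in general, which is why cycles have to be corrected by
  \<open>lift_along_projection\<close>.\<close>

definition koszul_section ::
    "((nat \<Rightarrow> nat) \<times> nat set \<Rightarrow> 'k::field) \<Rightarrow> (nat \<Rightarrow> nat) \<times> nat set \<Rightarrow> 'k" where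
  "koszul_section c =
     (\<lambda>(a, \<sigma>). if (a, \<sigma>) \<in> koszul_cells then c (\<lambda>v. a v - of_bool (v \<in> \<sigma>), \<sigma>) else 0)"

lemma koszul_part_chains: "koszul_part i c \<in> kchains n E i j"
  by (auto simp: koszul_part_def kchains_def)

lemma koszul_part_add: "koszul_part i (f + g) = koszul_part i f + koszul_part i g"
  by (auto simp: koszul_part_def fun_eq_iff)

lemma koszul_part_diff: "koszul_part i (f - g) = koszul_part i f - koszul_part i g"
  by (auto simp: koszul_part_def fun_eq_iff)

lemma koszul_part_kscale: "koszul_part i (kscale r f) = kscale r (koszul_part i f)"
  by (auto simp: koszul_part_def kscale_def fun_eq_iff)

lemma koszul_part_sum: "koszul_part i (\<Sum>x\<in>A. f x) = (\<Sum>x\<in>A. koszul_part i (f x))"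
  by (auto simp: koszul_part_def fun_eq_iff sum_fun_eval)

lemma koszul_part_cong: "(\<And>x. x \<in> koszul_cells \<Longrightarrow> f x = g x) \<Longrightarrow> koszul_part i f = koszul_part i g"
  by (auto simp: koszul_part_def kbasis_iff fun_eq_iff)

lemma koszul_cells_shift:
  assumes "(a, \<sigma>) \<in> koszul_cells"
  shows "(\<lambda>v. a v - of_bool (v \<in> \<sigma>) + of_bool (v \<in> \<sigma>)) = a"
proof
  fix v
  have "of_bool (v \<in> \<sigma>) \<le> a v"
  proof (cases "v < n")
    case True
    then have "of_bool (v \<in> \<sigma>) + of_bool (v \<in> cover \<sigma>) \<le> a v"
      using assms by (auto simp: koszul_cells_def cells_def)
    then show ?thesis
      by simp
  next
    case False
    then show ?thesis
      using assms by (auto simp: koszul_cells_def)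
  qed
  then show "a v - of_bool (v \<in> \<sigma>) + of_bool (v \<in> \<sigma>) = a v"
    by simp
qed

lemma koszul_part_section: "c \<in> kchains n E i j \<Longrightarrow> koszul_part i (koszul_section c) = c"
  by (auto simp: koszul_part_def koszul_section_def kbasis_iff kchains_def fun_eq_iff)

lemma koszul_section_chains:
  assumes "c \<in> kchains n E i j"
  shows "koszul_section c \<in> chains_on (cells \<inter> dgr i)"
proof (rule chainsI, clarify)
  fix a \<sigma> assume not_in: "(a, \<sigma>) \<notin> cells \<inter> dgr i"
  show "koszul_section c (a, \<sigma>) = 0"
  proof (cases "(a, \<sigma>) \<in> koszul_cells")
    case True
    then have "(\<lambda>v. a v - of_bool (v \<in> \<sigma>), \<sigma>) \<notin> kbasis n E i j"
      unfolding kbasis_iff koszul_cells_shift[OF True] using not_in koszul_cells_subset by auto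
    then show ?thesis
      using assms by (simp add: koszul_section_def kchains_def)
  qed (simp add: koszul_section_def)
qed

lemma koszul_part_eq_0_imp:
  assumes "koszul_part i c = 0" "c \<in> chains_on (cells \<inter> dgr i)" "x \<in> koszul_cells"
  shows "c x = 0"
proof -
  obtain a \<sigma> where x: "x = (a, \<sigma>)"
    by force
  show ?thesis
  proof (cases "x \<in> dgr i")
    case True
    then have "(\<lambda>v. a v - of_bool (v \<in> \<sigma>), \<sigma>) \<in> kbasis n E i j"
      using assms(3) koszul_cells_shift[of a \<sigma>] by (simp add: kbasis_iff x)
    then show ?thesis
      using fun_cong[OF assms(1), of "(\<lambda>v. a v - of_bool (v \<in> \<sigma>), \<sigma>)"] assms(3)
        koszul_cells_shift[of a \<sigma>] by (simp add: koszul_part_def x)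
  next
    case False
    then show ?thesis
      using chainsD[OF assms(2)] by simp
  qed
qed

lemma kdiff_koszul_part:
  assumes "c \<in> chains_on cells"
  shows "kdiff n E (Suc i) j (koszul_part (Suc i) c) = koszul_part i (bd N c)"
proof (rule ext, clarify)
  fix m :: "nat \<Rightarrow> nat" and G
  show "kdiff n E (Suc i) j (koszul_part (Suc i) c) (m, G) = koszul_part i (bd N c) (m, G)"
  proof (cases "(m, G) \<in> kbasis n E i j")
    case True
    let ?a = "\<lambda>v. m v + of_bool (v \<in> G)"
    let ?K = "{k. k < n \<and> k \<notin> G \<and> 0 < m k}"
    have G: "G \<subseteq> {..<n}" "finite G"
      using True by (auto simp: kbasis_def intro: finite_subset)
    have cell: "(?a, G) \<in> koszul_cells"
      using True by (simp add: kbasis_iff)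
    have summand: "(- 1) ^ card {l \<in> G. l < k} * koszul_part (Suc i) c (m(k := m k - 1), insert k G)
        = ksign G k * c (?a, insert k G)" if "k \<in> ?K" for k
    proof -
      have shift: "(\<lambda>v. (m(k := m k - 1)) v + of_bool (v \<in> insert k G)) = ?a"
        using that by auto
      have "(\<Sum>v<n. (m(k := m k - 1)) v) + 1 = (\<Sum>v<n. m v)"
        using that sum.remove[of "{..<n}" k m] sum.remove[of "{..<n}" k "m(k := m k - 1)"]
        by simp
      moreover have "card (insert k G) = Suc i"
        using True that G by (simp add: kbasis_def)
      moreover have "monomial_ok n E (m(k := m k - 1))"
      proof -
        have "{v. 0 < (m(k := m k - 1)) v} \<subseteq> {v. 0 < m v}"
          by (auto split: if_splits)
        then show ?thesis
          using True that unfolding kbasis_def monomial_ok_def by auto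
      qed
      ultimately have "(m(k := m k - 1), insert k G) \<in> kbasis n E (Suc i) j"
        using True that by (auto simp: kbasis_def)
      then show ?thesis
        using shift by (simp add: koszul_part_def ksign_def)
    qed
    have "bd N c (?a, G) = (\<Sum>k\<in>?K. ksign G k * c (?a, insert k G))"
      unfolding bd_apply
    proof (rule sum.mono_neutral_right)
      \<comment> \<open>The cofaces that \<open>kdiff\<close> omits are no cells: an edge cannot be
        added to a Koszul cell, and a vertex \<open>k\<close> with \<open>m k = 0\<close> has no
        exponent to spare.\<close>
      show "\<forall>k\<in>{..<N} - G - ?K. ksign G k * c (?a, insert k G) = 0"
      proof
        fix k assume k: "k \<in> {..<N} - G - ?K"
        have "(?a, insert k G) \<notin> cells"
        proof
          assume *: "(?a, insert k G) \<in> cells"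
          then have "(?a, insert k G) \<in> koszul_cells"
            using koszul_cells_up[of ?a "insert k G" k] k cell by auto
          then have "k < n"
            by (auto simp: koszul_cells_def)
          then show False
            using * k by (force simp: cells_def)
        qed
        then show "ksign G k * c (?a, insert k G) = 0"
          using chainsD[OF assms] by simp
      qed
    qed (use le in auto)
    also have "\<dots> = kdiff n E (Suc i) j (koszul_part (Suc i) c) (m, G)"
      using True summand by (simp add: kdiff_def)
    finally show ?thesis
      using True by (simp add: koszul_part_def)
  next
    case False
    then show ?thesis
      by (simp add: kdiff_def koszul_part_def)
  qed
qed

definition koszul_cycles :: "nat \<Rightarrow> ((nat \<Rightarrow> nat) \<times> nat set \<Rightarrow> 'k::field) set" where
  "koszul_cycles i = {c \<in> kchains n E i j. i = 0 \<or> kdiff n E i j c = 0}"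

definition koszul_boundaries :: "nat \<Rightarrow> ((nat \<Rightarrow> nat) \<times> nat set \<Rightarrow> 'k::field) set" where
  "koszul_boundaries i = kdiff n E (i + 1) j ` kchains n E (i + 1) j"

lemma betti_eq:
  "betti TYPE('k::field) n E i j
    = fun_space.dim (koszul_cycles i :: (_ \<Rightarrow> 'k) set) - fun_space.dim (koszul_boundaries i :: (_ \<Rightarrow> 'k) set)"
  by (simp add: betti_def koszul_cycles_def koszul_boundaries_def)

lemma koszul_part_0: "koszul_part i 0 = 0"
  by (auto simp: koszul_part_def)

lemma koszul_part_cycle:
  assumes "z \<in> chains_on (cells \<inter> dgr i)" "bd N z = 0"
  shows "koszul_part i z \<in> koszul_cycles i"
proof (cases i)
  case 0
  then show ?thesis
    by (simp add: koszul_cycles_def koszul_part_chains)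
next
  case (Suc i')
  have "z \<in> chains_on cells"
    using assms(1) by (rule chains_mono) auto
  then have "kdiff n E i j (koszul_part i z) = 0"
    unfolding Suc by (simp only: kdiff_koszul_part assms(2) koszul_part_0)
  then show ?thesis
    by (simp add: koszul_cycles_def koszul_part_chains)
qed

lemma koszul_part_boundary:
  assumes "y \<in> chains_on (cells \<inter> dgr (Suc i))"
  shows "koszul_part i (bd N y) \<in> koszul_boundaries i"
proof -
  have "y \<in> chains_on cells"
    using assms by (rule chains_mono) auto
  then have "koszul_part i (bd N y) = kdiff n E (i + 1) j (koszul_part (i + 1) y)"
    by (simp add: kdiff_koszul_part)
  then show ?thesis
    using koszul_part_chains by (auto simp: koszul_boundaries_def)
qed

text \<open>The extension by zero of a Koszul cycle has a boundary that vanishes on the Koszul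
  cells, so it can be corrected inside the kernel.\<close>

lemma koszul_cycle_lift:
  fixes c :: "_ \<Rightarrow> 'k::field"
  assumes "c \<in> koszul_cycles i"
  shows "\<exists>z\<in>chains_on (cells \<inter> dgr i). bd N z = 0 \<and> koszul_part i z = c"
proof -
  have c: "c \<in> kchains n E i j"
    using assms by (simp add: koszul_cycles_def)
  have s: "koszul_section c \<in> chains_on (cells \<inter> dgr i)"
    using c by (rule koszul_section_chains)
  have "bd N (koszul_section c) x = 0" if x: "x \<in> koszul_cells" for x
  proof (cases i)
    case 0
    then show ?thesis
      using s bd_degree_0 by (metis zero_fun_apply)
  next
    case (Suc i')
    have "koszul_section c \<in> chains_on cells"
      using s by (rule chains_mono) auto
    then have "koszul_part i' (bd N (koszul_section c)) = kdiff n E i j c"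
      using kdiff_koszul_part[of "koszul_section c" i'] koszul_part_section[OF c] Suc by simp
    also have "\<dots> = 0"
      using assms Suc by (simp add: koszul_cycles_def)
    finally show ?thesis
      using bd_degree[of "koszul_section c" i'] s Suc x by (auto intro: koszul_part_eq_0_imp)
  qed
  then obtain z where z: "z \<in> chains_on (cells \<inter> dgr i)" "bd N z = 0"
    "\<And>x. x \<in> koszul_cells \<Longrightarrow> z x = koszul_section c x"
    using lift_along_projection[of koszul_cells "koszul_section c" i] s by auto
  have "koszul_part i z = koszul_part i (koszul_section c)"
    using z(3) by (rule koszul_part_cong)
  then show ?thesis
    using z koszul_part_section[OF c] by auto
qed

lemma koszul_boundary_lift:
  assumes "c \<in> koszul_boundaries i"
  shows "\<exists>y\<in>chains_on (cells \<inter> dgr (Suc i)). koszul_part i (bd N y) = c"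
proof -
  obtain c' where c': "c' \<in> kchains n E (Suc i) j" "c = kdiff n E (Suc i) j c'"
    using assms by (auto simp: koszul_boundaries_def)
  have s: "koszul_section c' \<in> chains_on (cells \<inter> dgr (Suc i))"
    using c'(1) by (rule koszul_section_chains)
  then have "koszul_section c' \<in> chains_on cells"
    by (rule chains_mono) auto
  then have "koszul_part i (bd N (koszul_section c')) = c"
    using kdiff_koszul_part[of "koszul_section c'" i] koszul_part_section[OF c'(1)] c'(2) by simp
  with s show ?thesis
    by blast
qed

lemma koszul_boundaries_subset: "koszul_boundaries i \<subseteq> koszul_cycles i"
proof
  fix c :: "_ \<Rightarrow> 'k::field" assume "c \<in> koszul_boundaries i"
  then obtain y where y: "y \<in> chains_on (cells \<inter> dgr (Suc i))" "koszul_part i (bd N y) = c"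
    using koszul_boundary_lift by blast
  then show "c \<in> koszul_cycles i"
    using koszul_part_cycle[OF bd_degree[OF y(1)] bd_bd] by simp
qed

lemma subspace_koszul_boundaries:
  "fun_space.subspace (koszul_boundaries i :: (_ \<Rightarrow> 'k::field) set)"
proof (rule fun_space.subspaceI)
  show "(0 :: _ \<Rightarrow> 'k) \<in> koszul_boundaries i"
    using koszul_part_boundary[OF zero_chains, of i] by (simp only: bd_zero koszul_part_0)
next
  fix f g :: "_ \<Rightarrow> 'k" assume "f \<in> koszul_boundaries i" "g \<in> koszul_boundaries i"
  then obtain y y' where "y \<in> chains_on (cells \<inter> dgr (Suc i))" "koszul_part i (bd N y) = f"
    "y' \<in> chains_on (cells \<inter> dgr (Suc i))" "koszul_part i (bd N y') = g"
    using koszul_boundary_lift by blast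
  then show "f + g \<in> koszul_boundaries i"
    using koszul_part_boundary[of "y + y'" i] by (simp only: bd_add koszul_part_add chains_add)
next
  fix r and f :: "_ \<Rightarrow> 'k" assume "f \<in> koszul_boundaries i"
  then obtain y where "y \<in> chains_on (cells \<inter> dgr (Suc i))" "koszul_part i (bd N y) = f"
    using koszul_boundary_lift by blast
  then show "kscale r f \<in> koszul_boundaries i"
    using koszul_part_boundary[of "kscale r y" i]
    by (simp only: bd_kscale koszul_part_kscale chains_kscale)
qed

lemma koszul_cycles_subset_span:
  "koszul_cycles i \<subseteq> fun_space.span (point ` kbasis n E i j :: (_ \<Rightarrow> 'k::field) set)"
  using chains_on_subset_span[OF finite_kbasis]
  by (auto simp: koszul_cycles_def kchains_def chains_on_def)

section \<open>Bounding the Betti number by counting Taylor cells\<close>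

lemma taylor_lift:
  assumes "(a, \<sigma>) \<in> taylor_cells \<inter> dgr i" "\<And>k. k \<in> \<sigma> \<Longrightarrow> (a, \<sigma> - {k}) \<notin> taylor_cells"
  shows "\<exists>z\<in>chains_on (cells \<inter> dgr i). bd N z = 0 \<and>
    (\<forall>y\<in>taylor_cells. z y = (point (a, \<sigma>) y :: 'k::field))"
proof (rule lift_along_projection)
  show "(point (a, \<sigma>) :: _ \<Rightarrow> 'k) \<in> chains_on (cells \<inter> dgr i)"
    using assms(1) taylor_cells_subset by (auto simp: chains_on_def point_def)
  fix x assume x: "x \<in> taylor_cells"
  obtain a' \<sigma>' where x': "x = (a', \<sigma>')"
    by force
  have "(a', insert k \<sigma>') \<noteq> (a, \<sigma>)" if "k \<notin> \<sigma>'" for k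
    using assms(2)[of k] x x' that by auto
  then show "bd N (point (a, \<sigma>)) x = (0 :: 'k)"
    unfolding x' bd_apply by (intro sum.neutral) (auto simp: point_def)
qed simp

text \<open>By \<open>out\<close> each cell of \<open>I\<close> is a cycle of the Taylor complex
  over \<open>K\<close> and lifts; by \<open>ins\<close> it has no coface, so every boundary has
  coefficient 0 there. This makes the lifts independent modulo boundaries.\<close>

lemma card_le_betti:
  assumes I: "finite I" "I \<subseteq> taylor_cells \<inter> dgr i"
    and out: "\<And>a \<sigma> k. (a, \<sigma>) \<in> I \<Longrightarrow> k \<in> \<sigma> \<Longrightarrow> (a, \<sigma> - {k}) \<notin> taylor_cells"
    and ins: "\<And>a \<sigma> k. (a, \<sigma>) \<in> I \<Longrightarrow> k \<notin> \<sigma> \<Longrightarrow> (a, insert k \<sigma>) \<notin> cells"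
  shows "card I \<le> betti TYPE('k::field) n E i j"
proof -
  let ?D = "chains_on (cells \<inter> dgr i) :: (_ \<Rightarrow> 'k) set"
  have "\<exists>z. z \<in> ?D \<and> bd N z = 0 \<and> (\<forall>y\<in>taylor_cells. z y = point x y)" if x: "x \<in> I" for x
  proof -
    obtain a \<sigma> where x': "x = (a, \<sigma>)"
      by force
    then show ?thesis
      using taylor_lift[of a \<sigma> i] out[of a \<sigma>] x I(2) by blast
  qed
  then obtain g where g: "\<And>x. x \<in> I \<Longrightarrow> g x \<in> ?D" "\<And>x. x \<in> I \<Longrightarrow> bd N (g x) = 0"
    "\<And>x y. x \<in> I \<Longrightarrow> y \<in> taylor_cells \<Longrightarrow> g x y = point x y"
    by metis
  have "fun_space.dim (koszul_boundaries i :: (_ \<Rightarrow> 'k) set) + card I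
      \<le> fun_space.dim (koszul_cycles i :: (_ \<Rightarrow> 'k) set)"
  proof (rule fun_space.dim_add_card_le[OF _ koszul_cycles_subset_span])
    show "(\<lambda>x. koszul_part i (g x)) ` I \<subseteq> koszul_cycles i"
      using koszul_part_cycle[OF g(1,2)] by (rule image_subsetI)
  next
    fix c :: "_ \<Rightarrow> 'k"
    assume "(\<Sum>x\<in>I. kscale (c x) (koszul_part i (g x))) \<in> koszul_boundaries i"
    then obtain y where y: "y \<in> chains_on (cells \<inter> dgr (Suc i))"
      "koszul_part i (bd N y) = (\<Sum>x\<in>I. kscale (c x) (koszul_part i (g x)))"
      using koszul_boundary_lift by blast
    define s where "s = (\<Sum>x\<in>I. kscale (c x) (g x))"
    have s: "s \<in> ?D"
      unfolding s_def by (intro chains_sum chains_kscale g(1))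
    have "bd N s = (\<Sum>x\<in>I. kscale (c x) (bd N (g x)))"
      by (simp only: s_def bd_sum bd_kscale)
    also have "\<dots> = (\<Sum>x\<in>I. 0)"
      by (intro sum.cong refl) (simp add: g(2) kscale_def fun_eq_iff)
    finally have bs: "bd N s = 0"
      by (simp only: sum.neutral_const)
    have part: "koszul_part i (s - bd N y) = 0"
      by (simp only: koszul_part_diff y(2) s_def koszul_part_sum koszul_part_kscale diff_self)
    have D: "s - bd N y \<in> ?D"
      using s bd_degree[OF y(1)] by (rule chains_diff)
    have "bd N (s - bd N y) = 0"
      by (simp only: bd_diff bs bd_bd diff_self)
    then obtain w where w: "w \<in> chains_on ((cells - koszul_cells) \<inter> dgr (Suc i))" "bd N w = s - bd N y"
      using boundary_if_projection_zero[of koszul_cells "s - bd N y" i] D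
        koszul_part_eq_0_imp[OF part D] by blast
    have yw: "y + w \<in> chains_on cells"
      using y(1) w(1) by (intro chains_add) (auto elim: chains_mono)
    \<comment> \<open>A relation among the Koszul projections becomes one in the double complex,
      with \<open>w\<close> making up for what the projection forgets; there it can be evaluated at
      the cells of \<open>I\<close>.\<close>
    have eq: "s = bd N (y + w)"
      by (simp only: bd_add w(2) add_diff_eq add_diff_cancel_left')
    show "\<forall>x\<in>I. c x = 0"
    proof
      fix x assume x: "x \<in> I"
      obtain a \<sigma> where x': "x = (a, \<sigma>)"
        by force
      have "bd N (y + w) x = 0"
        unfolding x' bd_apply using ins[of a \<sigma>] x x' chainsD[OF yw]
        by (intro sum.neutral) auto
      then have "s x = 0"
        using eq by simp
      moreover have "s x = (\<Sum>x'\<in>I. c x' * of_bool (x = x'))"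
        unfolding s_def sum_fun_eval kscale_def
      proof (intro sum.cong refl)
        fix x' assume "x' \<in> I"
        then have "g x' x = point x' x"
          using x I(2) by (intro g(3)) auto
        then show "c x' * g x' x = c x' * of_bool (x = x')"
          by (simp add: point_def)
      qed
      ultimately show "c x = 0"
        using x I(1) by (simp add: of_bool_def if_distrib cong: if_cong)
    qed
  qed (use I finite_kbasis koszul_boundaries_subset subspace_koszul_boundaries in auto)
  then show ?thesis
    by (simp add: betti_eq)
qed

lemma finite_taylor_cells: "finite taylor_cells"
proof (rule finite_subset)
  show "taylor_cells \<subseteq> (\<lambda>\<sigma>. (\<lambda>v. of_bool (v \<in> cover \<sigma>), \<sigma>)) ` Pow {..<N}"
    by (auto simp: taylor_cells_def cells_def)
qed simp

text \<open>Among the facets of \<open>insert u \<sigma>\<close>, only the one omitting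
  \<open>u\<close> is a Taylor cell, so a single term of the boundary survives in the Taylor
  complex.\<close>

lemma taylor_boundary:
  assumes x: "(a, \<sigma>) \<in> taylor_cells \<inter> dgr i" and u: "u \<notin> \<sigma>" "(a, insert u \<sigma>) \<in> cells"
    and out: "\<And>k. k \<in> \<sigma> \<Longrightarrow> (a, insert u (\<sigma> - {k})) \<notin> taylor_cells"
  shows "\<exists>y\<in>chains_on (cells \<inter> dgr (Suc i)).
    \<forall>t\<in>taylor_cells. bd N y t = (point (a, \<sigma>) t :: 'k::field)"
proof -
  \<comment> \<open>The factor cancels the sign with which \<open>\<sigma>\<close> occurs in the
    boundary, a sign being its own inverse.\<close>
  define y :: "_ \<Rightarrow> 'k" where "y = kscale (ksign \<sigma> u) (point (a, insert u \<sigma>))"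
  have "finite \<sigma>" "u < N"
    using u(2) cells_finite[of a "insert u \<sigma>"] by (auto simp: cells_def)
  then have "(a, insert u \<sigma>) \<in> cells \<inter> dgr (Suc i)"
    using u x by (auto simp: dgr_def)
  then have y: "y \<in> chains_on (cells \<inter> dgr (Suc i))"
    by (auto simp: y_def chains_on_def kscale_def point_def)
  have "bd N y t = point (a, \<sigma>) t" if t: "t \<in> taylor_cells" for t
  proof -
    obtain a' \<sigma>' where t': "t = (a', \<sigma>')"
      by force
    have y_eq: "y (a', insert k \<sigma>') = ksign \<sigma> u * of_bool (k = u \<and> a' = a \<and> \<sigma>' = \<sigma>)"
      if "k \<notin> \<sigma>'" for k
    proof -
      have "k = u \<and> \<sigma>' = \<sigma>" if eq: "a' = a" "insert k \<sigma>' = insert u \<sigma>"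
      proof (rule ccontr)
        assume "\<not> (k = u \<and> \<sigma>' = \<sigma>)"
        then have "k \<noteq> u"
          using eq \<open>k \<notin> \<sigma>'\<close> u(1) by (metis insert_ident)
        then have "k \<in> \<sigma>" "\<sigma>' = insert u (\<sigma> - {k})"
          using eq \<open>k \<notin> \<sigma>'\<close> by auto
        then show False
          using out t t' eq(1) by auto
      qed
      then show ?thesis
        by (auto simp: y_def kscale_def point_def)
    qed
    have "bd N y t = (\<Sum>k\<in>{..<N} - \<sigma>'. ksign \<sigma>' k * (ksign \<sigma> u * of_bool (k = u \<and> a' = a \<and> \<sigma>' = \<sigma>)))"
      unfolding t' bd_apply by (intro sum.cong refl) (simp add: y_eq)
    also have "\<dots> = of_bool (a' = a \<and> \<sigma>' = \<sigma>)"
    proof (cases "a' = a \<and> \<sigma>' = \<sigma>")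
      case True
      then have "(\<Sum>k\<in>{..<N} - \<sigma>'. ksign \<sigma>' k * (ksign \<sigma> u * of_bool (k = u \<and> a' = a \<and> \<sigma>' = \<sigma>)))
          = (\<Sum>k\<in>{..<N} - \<sigma>. if k = u then ksign \<sigma> u * ksign \<sigma> u else 0 :: 'k)"
        by (intro sum.cong) auto
      then show ?thesis
        using True u(1) \<open>u < N\<close> by (simp add: ksign_square)
    next
      case False
      then show ?thesis
        by (intro trans[OF sum.neutral]) auto
    qed
    finally show ?thesis
      by (simp add: t' point_def)
  qed
  with y show ?thesis
    by blast
qed

text \<open>By \<open>irr\<close> all Taylor cells of degree \<open>i\<close> lift to cycles, and
  combinations of these lifts reproduce the Taylor coordinates of any cycle. For cells outside
  \<open>J\<close> the lift is chosen to be a boundary, so modulo boundaries only \<open>J\<close>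
  counts.\<close>

lemma betti_le_card:
  assumes irr: "\<And>a \<sigma> k. (a, \<sigma>) \<in> taylor_cells \<inter> dgr i \<Longrightarrow> k \<in> \<sigma> \<Longrightarrow> (a, \<sigma> - {k}) \<notin> taylor_cells"
    and J: "J \<subseteq> taylor_cells"
    and ins: "\<And>a \<sigma>. (a, \<sigma>) \<in> taylor_cells \<inter> dgr i - J \<Longrightarrow>
      \<exists>u. u \<notin> \<sigma> \<and> (a, insert u \<sigma>) \<in> cells \<and> (\<forall>k\<in>\<sigma>. (a, insert u (\<sigma> - {k})) \<notin> taylor_cells)"
  shows "betti TYPE('k::field) n E i j \<le> card J"
proof -
  let ?D = "chains_on (cells \<inter> dgr i) :: (_ \<Rightarrow> 'k) set"
  let ?T = "taylor_cells \<inter> dgr i"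
  let ?B = "koszul_boundaries i :: (_ \<Rightarrow> 'k) set"
  have "\<exists>z. z \<in> ?D \<and> bd N z = 0 \<and> (\<forall>t\<in>taylor_cells. z t = point x t) \<and>
      (x \<notin> J \<longrightarrow> koszul_part i z \<in> ?B)" if x: "x \<in> ?T" for x
  proof -
    obtain a \<sigma> where x': "x = (a, \<sigma>)"
      by force
    show ?thesis
    proof (cases "x \<in> J")
      case True
      then show ?thesis
        using taylor_lift[of a \<sigma> i] irr[of a \<sigma>] x x' by blast
    next
      case False
      then obtain y where "y \<in> chains_on (cells \<inter> dgr (Suc i))"
        "\<forall>t\<in>taylor_cells. bd N y t = (point x t :: 'k)"
        using ins[of a \<sigma>] taylor_boundary[of a \<sigma> i] x x' by blast
      then show ?thesis
        using bd_degree bd_bd koszul_part_boundary by blast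
    qed
  qed
  then obtain g where g: "\<And>x. x \<in> ?T \<Longrightarrow> g x \<in> ?D" "\<And>x. x \<in> ?T \<Longrightarrow> bd N (g x) = 0"
    "\<And>x t. x \<in> ?T \<Longrightarrow> t \<in> taylor_cells \<Longrightarrow> g x t = point x t"
    "\<And>x. x \<in> ?T \<Longrightarrow> x \<notin> J \<Longrightarrow> koszul_part i (g x) \<in> ?B"
    by metis
  let ?G = "(\<lambda>x. koszul_part i (g x)) ` J"
  have finite_J: "finite J"
    using J finite_taylor_cells by (rule finite_subset)
  have "koszul_cycles i \<subseteq> fun_space.span (?B \<union> ?G)"
  proof
    fix c :: "_ \<Rightarrow> 'k" assume "c \<in> koszul_cycles i"
    then obtain z where z: "z \<in> ?D" "bd N z = 0" "koszul_part i z = c"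
      using koszul_cycle_lift by blast
    \<comment> \<open>\<open>s\<close> copies the Taylor coordinates of \<open>z\<close>, so
      \<open>z - s\<close> has zero Taylor projection and is a boundary.\<close>
    define s where "s = (\<Sum>x\<in>?T. kscale (z x) (g x))"
    have s: "s \<in> ?D"
      unfolding s_def by (intro chains_sum chains_kscale g(1))
    have "bd N s = (\<Sum>x\<in>?T. kscale (z x) (bd N (g x)))"
      by (simp only: s_def bd_sum bd_kscale)
    also have "\<dots> = (\<Sum>x\<in>?T. 0)"
      by (intro sum.cong refl) (simp only: g(2) fun_space.scale_zero_right)
    finally have bs: "bd N s = 0"
      by (simp only: sum.neutral_const)
    have "s t = z t" if t: "t \<in> taylor_cells" for t
    proof -
      have "s t = (\<Sum>x\<in>?T. z x * of_bool (t = x))"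
        unfolding s_def sum_fun_eval kscale_def
        by (intro sum.cong refl) (simp only: g(3)[OF _ t] point_def)
      also have "\<dots> = (if t \<in> ?T then z t else 0)"
        using finite_taylor_cells by (simp add: of_bool_def if_distrib cong: if_cong)
      finally show ?thesis
        using t chainsD[OF z(1), of t] by auto
    qed
    moreover have "z - s \<in> ?D"
      using z(1) s by (rule chains_diff)
    moreover have "bd N (z - s) = 0"
      by (simp only: bd_diff z(2) bs diff_self)
    ultimately obtain w where w: "w \<in> chains_on ((cells - taylor_cells) \<inter> dgr (Suc i))" "bd N w = z - s"
      using boundary_if_projection_zero[of taylor_cells "z - s" i] by auto
    have "w \<in> chains_on (cells \<inter> dgr (Suc i))"
      using w(1) by (rule chains_mono) auto
    then have "koszul_part i (z - s) \<in> fun_space.span (?B \<union> ?G)"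
      unfolding w(2)[symmetric] using koszul_part_boundary by (intro fun_space.span_base) auto
    moreover have "koszul_part i s \<in> fun_space.span (?B \<union> ?G)"
      unfolding s_def koszul_part_sum koszul_part_kscale
      using g(4) by (intro fun_space.span_sum fun_space.span_scale fun_space.span_base) auto
    ultimately have "koszul_part i (z - s) + koszul_part i s \<in> fun_space.span (?B \<union> ?G)"
      by (rule fun_space.span_add)
    then show "c \<in> fun_space.span (?B \<union> ?G)"
      by (simp only: koszul_part_diff diff_add_cancel z(3))
  qed
  then have "fun_space.dim (koszul_cycles i :: (_ \<Rightarrow> 'k) set) \<le> fun_space.dim ?B + card ?G"
    using finite_kbasis finite_J
    by (intro fun_space.dim_le_dim_add_card[OF _ koszul_cycles_subset_span koszul_boundaries_subset]) auto
  moreover have "card ?G \<le> card J"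
    using finite_J by (rule card_image_le)
  ultimately show ?thesis
    by (simp add: betti_eq)
qed

section \<open>Families of edges as cells\<close>

lemma finite_E: "finite E"
  using enum bij_betw_finite by blast

definition idx :: "nat set set \<Rightarrow> nat set" where
  "idx \<S> = {u \<in> {n..<N}. e u \<in> \<S>}"

text \<open>The first component is the exponent vector of the lcm of the edge monomials; its total
  degree is the second entry of the type.\<close>

definition family_cell :: "nat set set \<Rightarrow> (nat \<Rightarrow> nat) \<times> nat set" where
  "family_cell \<S> = (\<lambda>v. of_bool (v \<in> \<Union>\<S>), idx \<S>)"

lemma image_idx: "\<S> \<subseteq> E \<Longrightarrow> e ` idx \<S> = \<S>"
  by (force simp: idx_def elim: edge_obtain)

lemma inj_on_family_cell: "inj_on family_cell (Pow E)"
  by (rule inj_on_inverseI[of _ "\<lambda>x. e ` snd x"]) (simp add: family_cell_def image_idx)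

lemma card_idx: "card (idx \<S>) = card \<S>" if "\<S> \<subseteq> E"
proof -
  have "inj_on e (idx \<S>)"
    by (auto simp: inj_on_def idx_def edge_inj)
  from card_image[OF this] show ?thesis
    using image_idx[OF that] by simp
qed

lemma cover_idx: "cover (idx \<S>) = \<Union>\<S>" if "\<S> \<subseteq> E"
proof -
  have "cover (idx \<S>) = \<Union>(e ` idx \<S>)"
    by (auto simp: cover_def idx_def)
  then show ?thesis
    using image_idx[OF that] by simp
qed

lemma idx_remove: "u \<in> idx \<S> \<Longrightarrow> idx \<S> - {u} = idx (\<S> - {e u})"
  by (auto simp: idx_def edge_inj)

lemma idx_insert: "n \<le> u \<Longrightarrow> u < N \<Longrightarrow> insert u (idx \<S>) = idx (insert (e u) \<S>)"
  by (auto simp: idx_def edge_inj)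

lemma Union_edges_bound: "\<S> \<subseteq> E \<Longrightarrow> \<Union>\<S> \<subseteq> {..<n}"
  using edge_bound by fastforce

lemma sum_of_bool_mem: "W \<subseteq> {..<n} \<Longrightarrow> (\<Sum>v<n. of_bool (v \<in> W)) = card W"
  by (simp add: Int_absorb1)

text \<open>This is divisibility of \<open>x^W\<close> by the lcm of the family; for Taylor cells
  the quotient must moreover be 1.\<close>

lemma cells_idx_iff:
  assumes "\<S> \<subseteq> E" "W \<subseteq> {..<n}" "card W = j"
  shows "(\<lambda>v. of_bool (v \<in> W), idx \<S>) \<in> cells \<longleftrightarrow> \<Union>\<S> \<subseteq> W"
proof -
  have "(\<Sum>v<n. of_bool (v \<in> W)) = j"
    using assms by (simp only: sum_of_bool_mem)
  moreover have "\<forall>v\<ge>n. v \<notin> W"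
    using assms(2) by auto
  moreover have "idx \<S> \<subseteq> {..<N}" "\<And>v. v < n \<Longrightarrow> v \<notin> idx \<S>"
    by (auto simp: idx_def)
  moreover have "(\<forall>v<n. of_bool (v \<in> \<Union>\<S>) \<le> (of_bool (v \<in> W) :: nat)) \<longleftrightarrow> \<Union>\<S> \<subseteq> W"
    using Union_edges_bound[OF assms(1)] by (auto simp: of_bool_def split: if_splits)
  ultimately show ?thesis
    by (simp add: cells_def cover_idx[OF assms(1)])
qed

lemma taylor_idx_iff:
  assumes "\<S> \<subseteq> E" "W \<subseteq> {..<n}" "card W = j"
  shows "(\<lambda>v. of_bool (v \<in> W), idx \<S>) \<in> taylor_cells \<longleftrightarrow> \<Union>\<S> = W"
proof -
  have "idx \<S> \<inter> {..<n} = {}"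
    by (auto simp: idx_def)
  moreover have "(\<lambda>v. of_bool (v \<in> W) :: nat) = (\<lambda>v. of_bool (v \<in> \<Union>\<S>)) \<longleftrightarrow> \<Union>\<S> = W"
    by (auto simp: fun_eq_iff of_bool_def split: if_splits)
  ultimately show ?thesis
    using cells_idx_iff[OF assms] by (auto simp: taylor_cells_def cover_idx[OF assms(1)])
qed

lemma taylor_cells_dgr_eq:
  "taylor_cells \<inter> dgr i = family_cell ` {\<S>. \<S> \<subseteq> E \<and> card \<S> = i \<and> card (\<Union>\<S>) = j}"
proof (intro equalityI subsetI)
  fix x assume x: "x \<in> taylor_cells \<inter> dgr i"
  obtain a \<sigma> where x': "x = (a, \<sigma>)"
    by force
  have \<sigma>: "\<sigma> \<subseteq> {n..<N}" and a: "a = (\<lambda>v. of_bool (v \<in> cover \<sigma>))" and sum: "(\<Sum>v<n. a v) = j"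
    using x x' by (fastforce simp: taylor_cells_def cells_def)+
  have E: "e ` \<sigma> \<subseteq> E"
    using \<sigma> edge_in by auto
  have idx: "idx (e ` \<sigma>) = \<sigma>"
    using \<sigma> by (force simp: idx_def edge_inj)
  have U: "cover \<sigma> = \<Union>(e ` \<sigma>)"
    using cover_idx[OF E] idx by simp
  have "card (\<Union>(e ` \<sigma>)) = j"
    using sum unfolding a U sum_of_bool_mem[OF Union_edges_bound[OF E]] .
  moreover have "card (e ` \<sigma>) = i"
    using card_idx[OF E] idx x x' by (simp add: dgr_def)
  moreover have "x = family_cell (e ` \<sigma>)"
    by (simp add: family_cell_def x' idx a U)
  ultimately show "x \<in> family_cell ` {\<S>. \<S> \<subseteq> E \<and> card \<S> = i \<and> card (\<Union>\<S>) = j}"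
    using E by blast
next
  fix x assume "x \<in> family_cell ` {\<S>. \<S> \<subseteq> E \<and> card \<S> = i \<and> card (\<Union>\<S>) = j}"
  then obtain \<S> where S: "\<S> \<subseteq> E" "card \<S> = i" "card (\<Union>\<S>) = j" and x: "x = family_cell \<S>"
    by blast
  have "x \<in> taylor_cells"
    using taylor_idx_iff[OF S(1) Union_edges_bound[OF S(1)] S(3)] by (simp only: x family_cell_def)
  moreover have "x \<in> dgr i"
    using card_idx[OF S(1)] S(2) by (simp add: x family_cell_def dgr_def)
  ultimately show "x \<in> taylor_cells \<inter> dgr i"
    by blast
qed

text \<open>The union uses up the squarefree multidegree, so no vertex fits, and an edge fits only
  inside the union.\<close>

lemma cells_insert_family:
  assumes "\<S> \<subseteq> E" "card (\<Union>\<S>) = j" "k \<notin> idx \<S>"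
  shows "(\<lambda>v. of_bool (v \<in> \<Union>\<S>), insert k (idx \<S>)) \<in> cells
    \<longleftrightarrow> n \<le> k \<and> k < N \<and> e k \<notin> \<S> \<and> e k \<subseteq> \<Union>\<S>"
proof (cases "n \<le> k \<and> k < N")
  case True
  then have "e k \<notin> \<S>" "insert (e k) \<S> \<subseteq> E"
    using assms edge_in by (auto simp: idx_def)
  then show ?thesis
    using True cells_idx_iff[OF _ Union_edges_bound[OF assms(1)] assms(2), of "insert (e k) \<S>"]
    by (simp add: idx_insert)
next
  case False
  have "(\<lambda>v. of_bool (v \<in> \<Union>\<S>), insert k (idx \<S>)) \<notin> cells"
  proof
    assume *: "(\<lambda>v. of_bool (v \<in> \<Union>\<S>), insert k (idx \<S>)) \<in> cells"
    then have "k < n"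
      using False by (auto simp: cells_def)
    then have cover: "cover (insert k (idx \<S>)) = \<Union>\<S>"
      by (simp only: cover_insert_vertex cover_idx[OF assms(1)])
    have "\<forall>v<n. of_bool (v \<in> insert k (idx \<S>)) + of_bool (v \<in> cover (insert k (idx \<S>)))
        \<le> (of_bool (v \<in> \<Union>\<S>) :: nat)"
      using * unfolding cells_def mem_Collect_eq case_prod_conv by (elim conjE)
    \<comment> \<open>For \<open>k\<close> in the union the bound reads 2 \<le> 1, for any other
      vertex 1 \<le> 0.\<close>
    from this[rule_format, OF \<open>k < n\<close>] show False
      unfolding cover by simp
  qed
  then show ?thesis
    using False by blast
qed

lemma taylor_remove_family:
  assumes "\<S> \<subseteq> E" "card (\<Union>\<S>) = j" "k \<in> idx \<S>"
  shows "(\<lambda>v. of_bool (v \<in> \<Union>\<S>), idx \<S> - {k}) \<in> taylor_cells \<longleftrightarrow> e k \<subseteq> \<Union>(\<S> - {e k})"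
proof -
  have "e k \<in> \<S>" "\<S> - {e k} \<subseteq> E"
    using assms by (auto simp: idx_def)
  then show ?thesis
    unfolding idx_remove[OF assms(3)]
    using taylor_idx_iff[OF _ Union_edges_bound[OF assms(1)] assms(2), of "\<S> - {e k}"] by auto
qed

text \<open>The two clauses of the matching supply the two hypotheses of
  \<open>card_le_betti\<close>: irredundance rules out deletions, absence of further edges in the
  union rules out insertions.\<close>

lemma num_self_semi_induced_le_betti:
  "num_self_semi_induced E i j \<le> betti TYPE('k::field) n E i j"
proof -
  let ?F = "{\<S>. self_semi_induced E \<S> \<and> card \<S> = i \<and> card (\<Union>\<S>) = j}"
  have F: "?F \<subseteq> Pow E"
    by (auto simp: self_semi_induced_def)
  have "card (family_cell ` ?F) \<le> betti TYPE('k::field) n E i j"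
  proof (rule card_le_betti)
    show "finite (family_cell ` ?F)"
      using finite_subset[OF F] finite_E by simp
    show "family_cell ` ?F \<subseteq> taylor_cells \<inter> dgr i"
      unfolding taylor_cells_dgr_eq using F by blast
  next
    fix a \<sigma> k assume "(a, \<sigma>) \<in> family_cell ` ?F" and k: "k \<in> \<sigma>"
    then obtain \<S> where S: "self_semi_induced E \<S>" "card (\<Union>\<S>) = j"
      and x: "a = (\<lambda>v. of_bool (v \<in> \<Union>\<S>))" "\<sigma> = idx \<S>"
      by (auto simp: family_cell_def)
    then show "(a, \<sigma> - {k}) \<notin> taylor_cells"
      using taylor_remove_family[of \<S> k] k by (auto simp: self_semi_induced_def idx_def)
  next
    fix a \<sigma> k assume "(a, \<sigma>) \<in> family_cell ` ?F" and k: "k \<notin> \<sigma>"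
    then obtain \<S> where S: "self_semi_induced E \<S>" "card (\<Union>\<S>) = j"
      and x: "a = (\<lambda>v. of_bool (v \<in> \<Union>\<S>))" "\<sigma> = idx \<S>"
      by (auto simp: family_cell_def)
    then show "(a, insert k \<sigma>) \<notin> cells"
      using cells_insert_family[of \<S> k] k edge_in[of k] by (auto simp: self_semi_induced_def)
  qed
  moreover have "card (family_cell ` ?F) = card ?F"
    using inj_on_subset[OF inj_on_family_cell F] by (rule card_image)
  ultimately show ?thesis
    by (simp add: num_self_semi_induced_def)
qed

lemma betti_le_num_self_contained:
  assumes irr: "\<And>\<S> T. \<S> \<subseteq> E \<Longrightarrow> card \<S> = i \<Longrightarrow> card (\<Union>\<S>) = j \<Longrightarrow> T \<in> \<S> \<Longrightarrow> \<not> T \<subseteq> \<Union>(\<S> - {T})"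
  shows "betti TYPE('k::field) n E i j \<le> num_self_contained_semi_induced E i j"
proof -
  let ?F = "{\<S>. self_contained_semi_induced E \<S> \<and> card \<S> = i \<and> card (\<Union>\<S>) = j}"
  have F: "?F \<subseteq> {\<S>. \<S> \<subseteq> E \<and> card \<S> = i \<and> card (\<Union>\<S>) = j}" "finite ?F"
    using finite_E by (auto simp: self_contained_semi_induced_def intro: finite_subset[of _ "Pow E"])
  have "betti TYPE('k::field) n E i j \<le> card (family_cell ` ?F)"
  proof (rule betti_le_card)
    show "family_cell ` ?F \<subseteq> taylor_cells"
      using taylor_cells_dgr_eq[of i] F(1) by blast
  next
    fix a \<sigma> k assume "(a, \<sigma>) \<in> taylor_cells \<inter> dgr i" and k: "k \<in> \<sigma>"
    then obtain \<S> where S: "\<S> \<subseteq> E" "card \<S> = i" "card (\<Union>\<S>) = j"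
      and x: "a = (\<lambda>v. of_bool (v \<in> \<Union>\<S>))" "\<sigma> = idx \<S>"
      unfolding taylor_cells_dgr_eq by (auto simp: family_cell_def)
    then show "(a, \<sigma> - {k}) \<notin> taylor_cells"
      using taylor_remove_family[of \<S> k] irr[OF S, of "e k"] k by (auto simp: idx_def)
  next
    fix a \<sigma> assume "(a, \<sigma>) \<in> taylor_cells \<inter> dgr i - family_cell ` ?F"
    then obtain \<S> where S: "\<S> \<subseteq> E" "card \<S> = i" "card (\<Union>\<S>) = j"
      and x: "a = (\<lambda>v. of_bool (v \<in> \<Union>\<S>))" "\<sigma> = idx \<S>" and "\<S> \<notin> ?F"
      unfolding taylor_cells_dgr_eq by (auto simp: family_cell_def)
    \<comment> \<open>Irredundance holds by \<open>irr\<close>, so self-containedness can fail only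
      through its clause on further edges, and \<open>T\<close> is an edge violating it.\<close>
    then obtain T where T: "T \<in> E" "T \<notin> \<S>" "T \<subseteq> \<Union>\<S>" "\<And>T'. T' \<in> \<S> \<Longrightarrow> \<not> T' \<subseteq> T \<union> \<Union>(\<S> - {T'})"
      using irr[OF S] by (auto simp: self_contained_semi_induced_def)
    obtain u where u: "n \<le> u" "u < N" "e u = T"
      using T(1) by (rule edge_obtain)
    have "u \<notin> \<sigma>"
      using u T x by (auto simp: idx_def)
    moreover have "(a, insert u \<sigma>) \<in> cells"
      using cells_insert_family[OF S(1,3), of u] calculation u T x by simp
    moreover have "(a, insert u (\<sigma> - {k})) \<notin> taylor_cells" if k: "k \<in> \<sigma>" for k
    proof -
      have ek: "e k \<in> \<S>"
        using k x by (simp add: idx_def)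
      \<comment> \<open>Part of \<open>e k\<close> is covered neither by \<open>T\<close> nor by the
        remaining edges, so this facet of the enlarged family has a smaller union.\<close>
      have "\<Union>(insert T (\<S> - {e k})) \<noteq> \<Union>\<S>"
        using T(4)[OF ek] ek by auto
      moreover have "insert T (\<S> - {e k}) \<subseteq> E"
        using T S by auto
      moreover have "insert u (\<sigma> - {k}) = idx (insert T (\<S> - {e k}))"
        using k u x idx_remove idx_insert by metis
      ultimately show ?thesis
        using taylor_idx_iff[OF _ Union_edges_bound[OF S(1)] S(3)] x by metis
    qed
    ultimately show "\<exists>u. u \<notin> \<sigma> \<and> (a, insert u \<sigma>) \<in> cells \<and>
        (\<forall>k\<in>\<sigma>. (a, insert u (\<sigma> - {k})) \<notin> taylor_cells)"
      by blast
  qed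
  also have "\<dots> \<le> card ?F"
    using F(2) by (rule card_image_le)
  finally show ?thesis
    by (simp add: num_self_contained_semi_induced_def)
qed

end

section \<open>Enumerating the edges, and the theorem\<close>

text \<open>An enumeration of the edges by \<open>{0..<card E}\<close> is shifted by
  \<open>n\<close>, behind the vertices.\<close>

lemma hypergraph_enum_exists:
  assumes "simple_hypergraph n E"
  obtains N e where "hypergraph_enum n N E e"
proof -
  have "E \<subseteq> Pow {..<n}"
    using assms by (auto simp: simple_hypergraph_def)
  then have "finite E"
    by (rule finite_subset) simp
  then obtain h where h: "bij_betw h {0..<card E} E"
    using ex_bij_betw_nat_finite by blast
  have "bij_betw (\<lambda>u. u - n) {n..<n + card E} {0..<card E}"
    by (rule bij_betw_byWitness[of _ "\<lambda>u. u + n"]) auto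
  from bij_betw_trans[OF this h] have "hypergraph_enum n (n + card E) E (h \<circ> (\<lambda>u. u - n))"
    using assms by unfold_locales auto
  then show ?thesis
    by (rule that)
qed

theorem theorem2p5:
  fixes n i j :: nat and E :: "nat set set"
  assumes H: "simple_hypergraph n E"
  shows "((\<forall>s :: nat \<Rightarrow> nat set.
             inj_on s {1..i+1} \<and> s ` {1..i+1} \<subseteq> E \<and>
             s (i+1) \<subseteq> (\<Union>l\<in>{1..i}. s l) \<and> card (\<Union>l\<in>{1..i}. s l) = j \<longrightarrow>
             (\<forall>k\<in>{1..i}. \<not> s k \<subseteq> (\<Union>l\<in>{1..i+1} - {k}. s l)))
          \<longrightarrow> num_self_semi_induced E i j \<le> betti TYPE('k::field) n E i j)
       \<and> ((\<forall>s :: nat \<Rightarrow> nat set.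
             inj_on s {1..i} \<and> s ` {1..i} \<subseteq> E \<and> card (\<Union>l\<in>{1..i}. s l) = j \<longrightarrow>
             (\<forall>k\<in>{1..i}. \<not> s k \<subseteq> (\<Union>l\<in>{1..i} - {k}. s l)))
          \<longrightarrow> betti TYPE('k::field) n E i j \<le> num_self_contained_semi_induced E i j)"
proof -
  obtain N e where "hypergraph_enum n N E e"
    using H by (rule hypergraph_enum_exists)
  then interpret hypergraph_enum n N j E e .
  show ?thesis
  proof (intro conjI impI)
    show "num_self_semi_induced E i j \<le> betti TYPE('k) n E i j"
      by (rule num_self_semi_induced_le_betti)
  next
    assume irr: "\<forall>s :: nat \<Rightarrow> nat set.
      inj_on s {1..i} \<and> s ` {1..i} \<subseteq> E \<and> card (\<Union>l\<in>{1..i}. s l) = j \<longrightarrow>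
      (\<forall>k\<in>{1..i}. \<not> s k \<subseteq> (\<Union>l\<in>{1..i} - {k}. s l))"
    show "betti TYPE('k) n E i j \<le> num_self_contained_semi_induced E i j"
    proof (rule betti_le_num_self_contained)
      fix \<S> T assume S: "\<S> \<subseteq> E" "card \<S> = i" "card (\<Union>\<S>) = j" and T: "T \<in> \<S>"
      \<comment> \<open>Any enumeration of the family will do, since the hypothesis covers every
        position \<open>k\<close>, in particular that of \<open>T\<close>.\<close>
      obtain s where s: "bij_betw s {1..i} \<S>"
        using ex_bij_betw_nat_finite_1[OF finite_subset[OF S(1) finite_E]] S(2) by auto
      then have img: "s ` {1..i} = \<S>" and inj: "inj_on s {1..i}"
        by (auto simp: bij_betw_def)
      obtain k where k: "k \<in> {1..i}" "T = s k"
        using T img by auto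
      have "s ` ({1..i} - {k}) = \<S> - {T}"
        using inj_on_image_set_diff[OF inj, of "{1..i}" "{k}"] k img by auto
      then show "\<not> T \<subseteq> \<Union>(\<S> - {T})"
        using irr[rule_format, of s k] inj img S k by auto
    qed
  qed
qed

end
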